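(* For every finite graph $G$ and every integer $K$ there is a sequence $(\mathcal T_k,\mathcal V_k)_{0\le k\le K}$ of tree-decompositions of $G$ such that, for all $0\le k\le K$, (i) every $k$-inseparable set is contained in a unique part of $(\mathcal T_k,\mathcal V_k)$; (ii) distinct $K$-robust $k$-blocks lie in different parts of $(\mathcal T_k,\mathcal V_k)$; (iii) $(\mathcal T_k,\mathcal V_k)$ has adhesion at most $k$; (iv) if $k>0$ then $(\mathcal T_{k-1},\mathcal V_{k-1})\preccurlyeq(\mathcal T_k,\mathcal V_k)$; (v) $\mathrm{Aut}(G)$ acts on $\mathcal T_k$ as a group of automorphisms.
   Context: Separations. A separation of $G=(V,E)$ is an ordered pair $(A,B)$ with $A,B\subseteq V$ and $G[A]\cup G[B]=G$; its order is $|A\cap B|$, and a $k$-separation is a separation of order $k$. Write $(A,B)\le(C,D)$ if $A\subseteq C$ and $B\supseteq D$. Two separations $(A,B),(C,D)$ are nested if $(A,B)$ is $\le$-comparable with $(C,D)$ or with $(D,C)$; otherwise they cross. For two separations $(A,B),(C,D)$ the boundaries of the corners $A\cap D$ and $B\cap D$ are $\partial(A\cap D)=(A\cap D)\cap(B\cup C)$ and $\partial(B\cap D)=(B\cap D)\cap(A\cup C)$. Blocks. A set $X\subseteq V$ is $k$-inseparable if $|X|>k$ and no set $S$ of at most $k$ vertices separates two vertices of $X\setminus S$ in $G$. A $k$-block is a maximal $k$-inseparable set. A $k$-inseparable set $U$ is $K$-robust if for every $k$-separation $(C,D)$ with $U\subseteq D$ and every separation $(A,B)$ of order at most $K$ that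 crosses $(C,D)$ and satisfies $|\partial(A\cap D)|<k$ and $|\partial(B\cap D)|<k$, we have $U\subseteq A$ or $U\subseteq B$. A $K$-robust $k$-block is a $k$-block that is $K$-robust as a $k$-inseparable set. Tree-decompositions. A tree-decomposition of $G$ is a pair $(\mathcal T,\mathcal V)$ of a tree $\mathcal T$ and a family $\mathcal V=(V_t)_{t\in\mathcal T}$ of subsets of $V(G)$ (parts) covering $V(G)$, such that every edge of $G$ has both ends in some $V_t$, and $V_{t_1}\cap V_{t_3}\subseteq V_{t_2}$ whenever $t_2$ lies on the $t_1$–$t_3$ path in $\mathcal T$. Its adhesion is the maximum size of a set $V_t\cap V_{t'}$ with $tt'\in E(\mathcal T)$ ($0$ if there is no edge). For tree-decompositions write $(\mathcal T_m,\mathcal V_m)\preccurlyeq(\mathcal T_n,\mathcal V_n)$ if $\mathcal T_m$ is a minor of $\mathcal T_n$ and every part $V_t\in\mathcal V_m$ of the first is the union of those parts $V_{t'}$ of the second whose nodes $t'$ were contracted to the node $t$ of $\mathcal T_m$. In (v), the action meant is the one induced by the action of $\mathrm{Aut}(G)$ on the parts: there is an action $t\mapsto t^\alpha$ of $\mathrm{Aut}(G)$ on $\mathcal T_k$ by tree automorphisms with $V_{t^\alpha}=\alpha(V_t)$ for all nodes $t$ and all $\alpha\in\mathrm{Aut}(G)$. *)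

theory Defs
  imports "Graph_Theory.Digraph_Component" "HOL-Algebra.Bij"
begin

text \<open>
  Finite simple graphs are symmetric loopfree digraphs, \<^locale>\<open>pair_graph\<close>; an undirected
  edge \<open>uv\<close> is the pair of arcs \<open>(u,v)\<close>, \<open>(v,u)\<close>.  The null graph is allowed.
\<close>

section \<open>Separations\<close>

fun separation :: "'a pair_pre_digraph \<Rightarrow> 'a set \<times> 'a set \<Rightarrow> bool" where
  "separation G (A, B) \<longleftrightarrow>
     A \<subseteq> pverts G \<and> B \<subseteq> pverts G \<and>
     Digraph_Component.union (with_proj G \<restriction> A) (with_proj G \<restriction> B) = with_proj G"

fun sep_order :: "'a set \<times> 'a set \<Rightarrow> nat" where
  "sep_order (A, B) = card (A \<inter> B)"

fun sep_le :: "'a set \<times> 'a set \<Rightarrow> 'a set \<times> 'a set \<Rightarrow> bool" where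
  "sep_le (A, B) (C, D) \<longleftrightarrow> A \<subseteq> C \<and> D \<subseteq> B"

definition sep_comparable :: "'a set \<times> 'a set \<Rightarrow> 'a set \<times> 'a set \<Rightarrow> bool" where
  "sep_comparable S T \<longleftrightarrow> sep_le S T \<or> sep_le T S"

definition nested :: "'a set \<times> 'a set \<Rightarrow> 'a set \<times> 'a set \<Rightarrow> bool" where
  "nested S T \<longleftrightarrow> sep_comparable S T \<or> sep_comparable S (prod.swap T)"

abbreviation crosses :: "'a set \<times> 'a set \<Rightarrow> 'a set \<times> 'a set \<Rightarrow> bool" where
  "crosses S T \<equiv> \<not> nested S T"

text \<open>The boundary of the corner \<open>X \<inter> Y\<close> of the separations \<open>(X,X')\<close> and \<open>(Y,Y')\<close>.  Either
  separation may be given in reversed orientation, so that all four corners are covered.\<close>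

fun corner_boundary :: "'a set \<times> 'a set \<Rightarrow> 'a set \<times> 'a set \<Rightarrow> 'a set" where
  "corner_boundary (X, X') (Y, Y') = (X \<inter> Y) \<inter> (X' \<union> Y')"


section \<open>Blocks\<close>

definition separates :: "'a pair_pre_digraph \<Rightarrow> 'a set \<Rightarrow> 'a \<Rightarrow> 'a \<Rightarrow> bool" where
  "separates G S u v \<longleftrightarrow> \<not> u \<rightarrow>\<^sup>*\<^bsub>with_proj G \<restriction> (pverts G - S)\<^esub> v"

definition inseparable :: "'a pair_pre_digraph \<Rightarrow> nat \<Rightarrow> 'a set \<Rightarrow> bool" where
  "inseparable G k X \<longleftrightarrow>
     X \<subseteq> pverts G \<and> k < card X \<and>
     \<not> (\<exists>S u v. S \<subseteq> pverts G \<and> card S \<le> k \<and> u \<in> X - S \<and> v \<in> X - S \<and> u \<noteq> v \<and> separates G S u v)"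

definition block :: "'a pair_pre_digraph \<Rightarrow> nat \<Rightarrow> 'a set \<Rightarrow> bool" where
  "block G k X \<longleftrightarrow> inseparable G k X \<and> (\<forall>Y. inseparable G k Y \<and> X \<subseteq> Y \<longrightarrow> Y = X)"

definition robust :: "'a pair_pre_digraph \<Rightarrow> int \<Rightarrow> nat \<Rightarrow> 'a set \<Rightarrow> bool" where
  "robust G K k U \<longleftrightarrow>
     inseparable G k U \<and>
     (\<forall>C D A B.
        separation G (C, D) \<and> sep_order (C, D) = k \<and> U \<subseteq> D \<and>
        separation G (A, B) \<and> int (sep_order (A, B)) \<le> K \<and>
        crosses (A, B) (C, D) \<and>
        card (corner_boundary (A, B) (D, C)) < k \<and>
        card (corner_boundary (B, A) (D, C)) < k
        \<longrightarrow> U \<subseteq> A \<or> U \<subseteq> B)"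

definition robust_block :: "'a pair_pre_digraph \<Rightarrow> int \<Rightarrow> nat \<Rightarrow> 'a set \<Rightarrow> bool" where
  "robust_block G K k X \<longleftrightarrow> block G k X \<and> robust G K k X"


section \<open>Tree-decompositions\<close>

text \<open>The constant \<^const>\<open>tree\<close> cannot be used for undirected trees: a pair of opposite arcs is a
  \<^const>\<open>pre_digraph.cycle\<close> of length 2, so no symmetric digraph with an edge is a
  \<^const>\<open>forest\<close>.  In a simple graph the undirected cycles are the cycles of length at least 3.
  Connectedness includes having at least one node.\<close>

definition undirected_tree :: "'t pair_pre_digraph \<Rightarrow> bool" where
  "undirected_tree T \<longleftrightarrow>
     pair_graph T \<and> Digraph_Component.connected (with_proj T) \<and>
     \<not> (\<exists>p. pre_digraph.cycle (with_proj T) p \<and> 3 \<le> length p)"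

definition tree_decomposition ::
    "'a pair_pre_digraph \<Rightarrow> 't pair_pre_digraph \<Rightarrow> ('t \<Rightarrow> 'a set) \<Rightarrow> bool" where
  "tree_decomposition G T V \<longleftrightarrow>
     undirected_tree T \<and>
     (\<Union>t\<in>pverts T. V t) = pverts G \<and>
     (\<forall>(u, v)\<in>parcs G. \<exists>t\<in>pverts T. u \<in> V t \<and> v \<in> V t) \<and>
     (\<forall>t1 p t3. pre_digraph.apath (with_proj T) t1 p t3 \<longrightarrow>
        (\<forall>t2\<in>set (pre_digraph.awalk_verts (with_proj T) t1 p). V t1 \<inter> V t3 \<subseteq> V t2))"

definition adhesion :: "'t pair_pre_digraph \<Rightarrow> ('t \<Rightarrow> 'a set) \<Rightarrow> nat" where
  "adhesion T V = Max (insert 0 {card (V t \<inter> V t') | t t'. (t, t') \<in> parcs T})"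

text \<open>\<open>B\<close> exhibits \<open>M\<close> as a minor of \<open>H\<close>: the branch set \<open>B x\<close> consists of the vertices of \<open>H\<close>
  contracted to \<open>x\<close>.  As usual for minors, vertices of \<open>H\<close> outside all branch sets and
  edges of \<open>H\<close> may be deleted.\<close>

definition minor_model ::
    "'s pair_pre_digraph \<Rightarrow> 't pair_pre_digraph \<Rightarrow> ('s \<Rightarrow> 't set) \<Rightarrow> bool" where
  "minor_model M H B \<longleftrightarrow>
     (\<forall>x\<in>pverts M. B x \<subseteq> pverts H \<and> Digraph_Component.connected (with_proj H \<restriction> B x)) \<and>
     (\<forall>x\<in>pverts M. \<forall>y\<in>pverts M. x \<noteq> y \<longrightarrow> B x \<inter> B y = {}) \<and>
     (\<forall>(x, y)\<in>parcs M. \<exists>u\<in>B x. \<exists>v\<in>B y. (u, v) \<in> parcs H)"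

definition td_le ::
    "'s pair_pre_digraph \<Rightarrow> ('s \<Rightarrow> 'a set) \<Rightarrow> 't pair_pre_digraph \<Rightarrow> ('t \<Rightarrow> 'a set) \<Rightarrow> bool" where
  "td_le T1 V1 T2 V2 \<longleftrightarrow>
     (\<exists>B. minor_model T1 T2 B \<and> (\<forall>t\<in>pverts T1. V1 t = (\<Union>t'\<in>B t. V2 t')))"


section \<open>Automorphism groups\<close>

definition graph_auto :: "'a pair_pre_digraph \<Rightarrow> ('a \<Rightarrow> 'a) set" where
  "graph_auto G =
     {\<alpha> \<in> Bij (pverts G).
        \<forall>u\<in>pverts G. \<forall>v\<in>pverts G. (\<alpha> u, \<alpha> v) \<in> parcs G \<longleftrightarrow> (u, v) \<in> parcs G}"

definition GraphAut :: "'a pair_pre_digraph \<Rightarrow> ('a \<Rightarrow> 'a) monoid" where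
  "GraphAut G = BijGroup (pverts G) \<lparr>carrier := graph_auto G\<rparr>"

text \<open>An action of \<open>Aut(G)\<close> on \<open>T\<close> by tree automorphisms is a homomorphism
  \<open>\<phi> : Aut(G) \<rightarrow> Aut(T)\<close>; the node \<open>t\<^sup>\<alpha>\<close> is \<open>\<phi> \<alpha> t\<close>.\<close>

definition induces_action ::
    "'a pair_pre_digraph \<Rightarrow> 't pair_pre_digraph \<Rightarrow> ('t \<Rightarrow> 'a set) \<Rightarrow> bool" where
  "induces_action G T V \<longleftrightarrow>
     (\<exists>\<phi> \<in> hom (GraphAut G) (GraphAut T).
        \<forall>\<alpha> \<in> carrier (GraphAut G). \<forall>t\<in>pverts T. V (\<phi> \<alpha> t) = \<alpha> ` V t)"

end

theory Submission
  imports Defs "HOL-Library.Countable_Set"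
begin

text \<open>
  The tree-decompositions all come from one nested set of separations.  For two distinct
  \<open>K\<close>-robust \<open>k\<close>-blocks \<open>X\<close>, \<open>Y\<close> consider the separations of least possible order with \<open>X\<close> on
  the first side and \<open>Y\<close> on the second.  For every such pair at least one of these efficient
  distinguishers is selected, level by level in the order of the separations.  At level \<open>l\<close> only
  those are admitted that are nested with everything selected at lower levels, and among them
  those that cross the fewest separations of \<open>G\<close>.

  Admissible distinguishers exist by uncrossing.  If \<open>r\<close> of order \<open>l\<close> was selected earlier and
  crosses a distinguisher \<open>s\<close> of order \<open>m > l\<close>, then the blocks separated by \<open>s\<close> lie on one
  side of \<open>r\<close>, and submodularity either replaces \<open>s\<close> by a corner that is nested with \<open>r\<close>, or makes
  both corners on the other side of \<open>r\<close> have order below \<open>l\<close>.  Robustness says that the block on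
  that side lies in one of these two corners, so \<open>r\<close> was not efficient (\<open>uncross_lower\<close>).
  Robustness is assumed only for separations of order exactly \<open>k\<close>, but it passes to smaller orders
  by padding a separation with further vertices (\<open>robust_lower_order\<close>).  Two separations selected
  at the same level are nested because opposite corners of a crossing pair together cross strictly
  fewer separations than the pair itself (\<open>crossing_number_corners\<close>, \<open>least_crossing_nested\<close>).
  No choice is ever made, so the selected set is invariant under \<open>Aut(G)\<close>.

  The separations selected up to level \<open>k\<close> form a nested set \<open>N\<^sub>k\<close>, closed under reversal, and they
  determine \<open>T\<^sub>k\<close>: its nodes are the consistent orientations of \<open>N\<^sub>k\<close>, two of them are adjacent if
  they differ in a single separation, and the part of a node is the intersection of the sides it
  points to.  Every separation of \<open>N\<^sub>k\<close> is flipped along exactly one edge, which makes the graph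
  acyclic, and flipping maximal elements one at a time makes it connected.  A \<open>k\<close>-inseparable set
  orients \<open>N\<^sub>k\<close> and thereby chooses its unique part.  Restricting orientations from \<open>N\<^sub>k\<close> to \<open>N\<^sub>k\<^sub>-\<^sub>1\<close>
  contracts \<open>T\<^sub>k\<close> onto \<open>T\<^sub>k\<^sub>-\<^sub>1\<close>, and \<open>Aut(G)\<close> permutes orientations.
\<close>

\<comment> \<open>Separations are treated as atoms with sides \<open>fst\<close> and \<open>snd\<close>, not as explicit pairs.\<close>
declare split_paired_All [simp del] split_paired_Ex [simp del]

section \<open>Nested separations\<close>

lemma sep_le_refl [simp]: "sep_le s s"
  by (cases s) simp

lemma sep_le_trans: "sep_le r s \<Longrightarrow> sep_le s t \<Longrightarrow> sep_le r t"
  by (cases r; cases s; cases t) auto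

lemma sep_le_antisym: "sep_le s t \<Longrightarrow> sep_le t s \<Longrightarrow> s = t"
  by (cases s; cases t) auto

lemma sep_le_swap [simp]: "sep_le (prod.swap s) (prod.swap t) \<longleftrightarrow> sep_le t s"
  by (cases s; cases t) auto

lemma sep_le_swap_left: "sep_le (prod.swap s) t \<longleftrightarrow> sep_le (prod.swap t) s"
  by (cases s; cases t) auto

lemma sep_le_swap_right: "sep_le s (prod.swap t) \<longleftrightarrow> sep_le t (prod.swap s)"
  by (cases s; cases t) auto

lemma swap_eq_swap_iff [simp]: "prod.swap s = prod.swap t \<longleftrightarrow> s = t"
  by (metis swap_swap)

lemma nested_iff:
  "nested s t \<longleftrightarrow>
     sep_le s t \<or> sep_le t s \<or> sep_le s (prod.swap t) \<or> sep_le (prod.swap t) s"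
  by (auto simp: nested_def sep_comparable_def)

lemma nested_sym: "nested s t \<longleftrightarrow> nested t s"
  by (cases s; cases t) (auto simp: nested_iff)

lemma nested_swap_left [simp]: "nested (prod.swap s) t \<longleftrightarrow> nested s t"
  by (cases s; cases t) (auto simp: nested_iff)

lemma nested_swap_right [simp]: "nested s (prod.swap t) \<longleftrightarrow> nested s t"
  by (cases s; cases t) (auto simp: nested_iff)

lemma ex_sep_minimal:
  assumes "finite M" "M \<noteq> {}"
  shows "\<exists>m\<in>M. \<forall>x\<in>M. sep_le x m \<longrightarrow> x = m"
proof -
  have "\<exists>m\<in>M. \<forall>x\<in>M. x \<noteq> m \<longrightarrow> \<not> (sep_le x m \<and> x \<noteq> m)"
    by (rule Finite_Set.bex_min_element[OF assms(1) _ _ assms(2)])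
      (auto intro!: asymp_onI transp_onI dest: sep_le_antisym intro: sep_le_trans)
  then show ?thesis by blast
qed

lemma ex_sep_maximal:
  assumes "finite M" "M \<noteq> {}"
  shows "\<exists>m\<in>M. \<forall>x\<in>M. sep_le m x \<longrightarrow> x = m"
proof -
  obtain m where m: "m \<in> M" "\<forall>x\<in>prod.swap ` M. sep_le x (prod.swap m) \<longrightarrow> x = prod.swap m"
    using ex_sep_minimal[of "prod.swap ` M"] assms by blast
  have "x = m" if "x \<in> M" "sep_le m x" for x
  proof -
    have "prod.swap x = prod.swap m" using m(2) that by simp
    then show ?thesis by (metis swap_swap)
  qed
  then show ?thesis using m(1) by blast
qed

section \<open>Consistent orientations\<close>

text \<open>
  An orientation points from \<open>fst s\<close> towards \<open>snd s\<close> for each of its elements \<open>s\<close>. Two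
  elements of it never point away from each other: that is what closure under smaller
  separations rules out.
\<close>
definition partial_orientation :: "('a set \<times> 'a set) set \<Rightarrow> ('a set \<times> 'a set) set \<Rightarrow> bool" where
  "partial_orientation N \<sigma> \<longleftrightarrow>
     \<sigma> \<subseteq> N \<and> (\<forall>s\<in>\<sigma>. prod.swap s \<notin> \<sigma>) \<and> (\<forall>s\<in>N. \<forall>t\<in>\<sigma>. sep_le s t \<longrightarrow> s \<in> \<sigma>)"

definition orientations :: "('a set \<times> 'a set) set \<Rightarrow> ('a set \<times> 'a set) set set" where
  "orientations N = {\<sigma>. partial_orientation N \<sigma> \<and> (\<forall>s\<in>N. s \<in> \<sigma> \<or> prod.swap s \<in> \<sigma>)}"

text \<open>
  The nodes of the trees have to be natural numbers, hence a numbering of the finitely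
  many orientations.
\<close>
definition orientation_at :: "('a set \<times> 'a set) set \<Rightarrow> nat \<Rightarrow> ('a set \<times> 'a set) set" where
  "orientation_at N = from_nat_into (orientations N)"

definition orientation_tree :: "('a set \<times> 'a set) set \<Rightarrow> nat pair_pre_digraph" where
  "orientation_tree N =
     \<lparr>pverts = {..<card (orientations N)},
      parcs = {(i, j). i < card (orientations N) \<and> j < card (orientations N) \<and>
                (\<exists>s. orientation_at N i - orientation_at N j = {s})}\<rparr>"

definition part_of :: "'a set \<Rightarrow> ('a set \<times> 'a set) set \<Rightarrow> 'a set" where
  "part_of V \<sigma> = {v \<in> V. \<forall>s\<in>\<sigma>. v \<in> snd s}"

text \<open>
  The last assumption excludes separations whose first side lies in the second. Such a
  separation lies below its own reversal, so it would belong to every orientation and no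
  edge could flip it.
\<close>
locale tree_set =
  fixes N :: "('a set \<times> 'a set) set"
  assumes finite: "finite N"
    and swap: "s \<in> N \<Longrightarrow> prod.swap s \<in> N"
    and nested: "s \<in> N \<Longrightarrow> t \<in> N \<Longrightarrow> nested s t"
    and proper: "s \<in> N \<Longrightarrow> \<not> sep_le s (prod.swap s)"
begin

lemma proper': "s \<in> N \<Longrightarrow> \<not> sep_le (prod.swap s) s"
  using proper[OF swap] by simp

lemma swap_neq: "s \<in> N \<Longrightarrow> prod.swap s \<noteq> s"
  using proper by fastforce

lemma orientation_subset: "\<sigma> \<in> orientations N \<Longrightarrow> \<sigma> \<subseteq> N"
  by (auto simp: orientations_def partial_orientation_def)

lemma orientation_iff: "\<sigma> \<in> orientations N \<Longrightarrow> s \<in> N \<Longrightarrow> prod.swap s \<in> \<sigma> \<longleftrightarrow> s \<notin> \<sigma>"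
  by (auto simp: orientations_def partial_orientation_def)

lemma orientation_down:
  "\<sigma> \<in> orientations N \<Longrightarrow> t \<in> \<sigma> \<Longrightarrow> s \<in> N \<Longrightarrow> sep_le s t \<Longrightarrow> s \<in> \<sigma>"
  by (auto simp: orientations_def partial_orientation_def)

lemma orientationI:
  assumes "\<sigma> \<subseteq> N" "\<And>s. s \<in> N \<Longrightarrow> prod.swap s \<in> \<sigma> \<longleftrightarrow> s \<notin> \<sigma>"
    "\<And>s t. s \<in> N \<Longrightarrow> t \<in> \<sigma> \<Longrightarrow> sep_le s t \<Longrightarrow> s \<in> \<sigma>"
  shows "\<sigma> \<in> orientations N"
  using assms unfolding orientations_def partial_orientation_def by blast

lemma finite_orientations: "finite (orientations N)"
  by (rule finite_subset[of _ "Pow N"]) (auto simp: finite dest: orientation_subset)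

lemma orientation_eqI:
  assumes "\<sigma> \<in> orientations N" "\<tau> \<in> orientations N" "\<sigma> \<subseteq> \<tau>"
  shows "\<sigma> = \<tau>"
proof (intro equalityI assms(3) subsetI)
  fix s assume s: "s \<in> \<tau>"
  then have N: "s \<in> N" using orientation_subset assms by blast
  show "s \<in> \<sigma>"
    using orientation_iff[OF assms(1) N] orientation_iff[OF assms(2) N] s assms(3) by blast
qed

text \<open>
  A maximal partial orientation is total: a minimal separation among the unoriented ones
  can be added, since everything strictly below it is oriented already, and by closure the
  right way.
\<close>
lemma extend_partial_orientation:
  assumes P: "partial_orientation N P"
  obtains \<sigma> where "\<sigma> \<in> orientations N" "P \<subseteq> \<sigma>"
proof -
  let ?X = "{Q. partial_orientation N Q}"
  have "finite ?X"
    by (rule finite_subset[of _ "Pow N"]) (auto simp: finite partial_orientation_def)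
  from finite_has_maximal2[OF this, of P] P
  obtain Q where Q: "partial_orientation N Q" "P \<subseteq> Q"
    and max: "\<And>R. partial_orientation N R \<Longrightarrow> Q \<subseteq> R \<Longrightarrow> Q = R"
    by auto
  have Qs: "\<And>s. s \<in> Q \<Longrightarrow> s \<in> N" "\<And>s. s \<in> Q \<Longrightarrow> prod.swap s \<notin> Q"
    "\<And>s t. s \<in> N \<Longrightarrow> t \<in> Q \<Longrightarrow> sep_le s t \<Longrightarrow> s \<in> Q"
    using Q by (auto simp: partial_orientation_def)
  let ?U = "{s \<in> N. s \<notin> Q \<and> prod.swap s \<notin> Q}"
  have "?U = {}"
  proof (rule ccontr)
    assume ne: "?U \<noteq> {}"
    have "finite ?U" using finite by simp
    from ex_sep_minimal[OF this ne] obtain m where mU: "m \<in> ?U"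
      and minU: "\<forall>x\<in>?U. sep_le x m \<longrightarrow> x = m" by (elim bexE)
    have m: "m \<in> N" "m \<notin> Q" "prod.swap m \<notin> Q" using mU by auto
    have min: "x = m" if "x \<in> N" "x \<notin> Q" "prod.swap x \<notin> Q" "sep_le x m" for x
      using minU that by blast
    have "partial_orientation N (insert m Q)"
      unfolding partial_orientation_def
    proof (intro conjI ballI impI)
      show "insert m Q \<subseteq> N" using Qs(1) m(1) by blast
      fix s assume "s \<in> insert m Q"
      then show "prod.swap s \<notin> insert m Q"
        using Qs(2)[of s] m swap_neq[OF m(1)] by auto
    next
      fix s t assume st: "s \<in> N" "t \<in> insert m Q" "sep_le s t"
      show "s \<in> insert m Q"
      proof (cases "t = m")
        case True
        have "prod.swap s \<notin> Q"
          using Qs(3)[of "prod.swap m" "prod.swap s"] st True m swap[OF m(1)] by auto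
        then show ?thesis using min[of s] st True by blast
      next
        case False
        then show ?thesis using st Qs(3)[of s t] by blast
      qed
    qed
    from max[OF this] m show False by blast
  qed
  then have "Q \<in> orientations N"
    using Q by (auto simp: orientations_def simp del: split_paired_All)
  then show ?thesis using Q that by blast
qed

text \<open>
  Maximality of \<open>s\<close> is what makes the flipped set closed again: a separation below
  \<open>prod.swap s\<close> that is not in \<open>\<sigma>\<close> has its reversal in \<open>\<sigma>\<close> above \<open>s\<close>.
\<close>
lemma flip_maximal:
  assumes \<sigma>: "\<sigma> \<in> orientations N" and s: "s \<in> \<sigma>"
    and max: "\<And>t. t \<in> \<sigma> \<Longrightarrow> sep_le s t \<Longrightarrow> t = s"
  shows "insert (prod.swap s) (\<sigma> - {s}) \<in> orientations N"
proof (rule orientationI)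
  have sN: "s \<in> N" using s orientation_subset[OF \<sigma>] by blast
  show "insert (prod.swap s) (\<sigma> - {s}) \<subseteq> N"
    using orientation_subset[OF \<sigma>] swap[OF sN] by blast
  fix t assume t: "t \<in> N"
  show "prod.swap t \<in> insert (prod.swap s) (\<sigma> - {s}) \<longleftrightarrow> t \<notin> insert (prod.swap s) (\<sigma> - {s})"
  proof (cases "t = s \<or> t = prod.swap s")
    case True then show ?thesis using swap_neq[OF sN] swap_neq[OF sN, symmetric] by auto
  next
    case False
    then have "prod.swap t \<noteq> s" "prod.swap t \<noteq> prod.swap s" by (auto simp del: swap_simp)
    then show ?thesis using False orientation_iff[OF \<sigma> t] by blast
  qed
  fix u assume u: "u \<in> insert (prod.swap s) (\<sigma> - {s})" "sep_le t u"
  show "t \<in> insert (prod.swap s) (\<sigma> - {s})"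
  proof (cases "u = prod.swap s")
    case True
    have "t \<in> \<sigma>" if "t \<noteq> prod.swap s"
    proof (rule ccontr)
      assume "t \<notin> \<sigma>"
      then have "prod.swap t \<in> \<sigma>" using orientation_iff[OF \<sigma> t] by blast
      moreover have "sep_le s (prod.swap t)" using u True by (simp add: sep_le_swap_right)
      ultimately have "prod.swap t = s" using max by blast
      then show False using that by auto
    qed
    moreover have "t \<noteq> s" using u True proper[OF sN] by auto
    ultimately show ?thesis by blast
  next
    case False
    then have "u \<in> \<sigma>" "u \<noteq> s" using u by auto
    then have "t \<in> \<sigma>" "t \<noteq> s" using orientation_down[OF \<sigma>] t u(2) max by blast+
    then show ?thesis by blast
  qed
qed

text \<open>
  Conversely, all edges arise by flipping maximal elements.
\<close>
lemma diff_singleton_maximal: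
  assumes \<sigma>: "\<sigma> \<in> orientations N" and \<tau>: "\<tau> \<in> orientations N" and d: "\<sigma> - \<tau> = {s}"
  shows "\<And>t. t \<in> \<sigma> \<Longrightarrow> sep_le s t \<Longrightarrow> t = s"
    and "\<tau> = insert (prod.swap s) (\<sigma> - {s})"
proof -
  have s: "s \<in> \<sigma>" "s \<notin> \<tau>" "s \<in> N" using d orientation_subset[OF \<sigma>] by auto
  show "t = s" if "t \<in> \<sigma>" "sep_le s t" for t
    using orientation_down[OF \<tau> _ s(3) that(2)] d s(2) that(1) by blast
  show "\<tau> = insert (prod.swap s) (\<sigma> - {s})"
  proof (intro equalityI subsetI)
    fix t assume t: "t \<in> \<tau>"
    then have tN: "t \<in> N" using orientation_subset[OF \<tau>] by blast
    show "t \<in> insert (prod.swap s) (\<sigma> - {s})"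
    proof (cases "t \<in> \<sigma>")
      case True then show ?thesis using t s by blast
    next
      case False
      then have "prod.swap t = s"
        using orientation_iff[OF \<sigma> tN] orientation_iff[OF \<tau> tN] t d by blast
      then show ?thesis by auto
    qed
  next
    fix t assume "t \<in> insert (prod.swap s) (\<sigma> - {s})"
    then show "t \<in> \<tau>" using d orientation_iff[OF \<tau> s(3)] s(2) by blast
  qed
qed

lemma diff_swap:
  assumes "\<sigma> \<in> orientations N" "\<tau> \<in> orientations N"
  shows "\<tau> - \<sigma> = prod.swap ` (\<sigma> - \<tau>)"
proof -
  have sub: "\<tau>' - \<sigma>' \<subseteq> prod.swap ` (\<sigma>' - \<tau>')"
    if "\<sigma>' \<in> orientations N" "\<tau>' \<in> orientations N" for \<sigma>' \<tau>'
  proof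
    fix s assume s: "s \<in> \<tau>' - \<sigma>'"
    then have "s \<in> N" using orientation_subset[OF that(2)] by blast
    then have "prod.swap s \<in> \<sigma>' - \<tau>'"
      using s orientation_iff[OF that(1)] orientation_iff[OF that(2)] by blast
    then show "s \<in> prod.swap ` (\<sigma>' - \<tau>')" by (metis image_eqI swap_swap)
  qed
  have "prod.swap ` (\<sigma> - \<tau>) \<subseteq> prod.swap ` prod.swap ` (\<tau> - \<sigma>)"
    using sub[OF assms(2,1)] by (rule image_mono)
  then show ?thesis using sub[OF assms] by (auto simp: image_image)
qed

text \<open>
  Each \<open>s\<close> belongs to only one edge: nestedness compares every \<open>t\<close> with \<open>s\<close>, and in each
  of the four cases closure or the maximality of \<open>s\<close> decides the direction of \<open>t\<close>. The
  inequality excludes the reversal of \<open>s\<close> itself.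
\<close>
lemma maximal_orientation_eq:
  assumes \<sigma>: "\<sigma> \<in> orientations N" and s: "s \<in> \<sigma>"
    and max: "\<And>t. t \<in> \<sigma> \<Longrightarrow> sep_le s t \<Longrightarrow> t = s"
  shows "\<sigma> = {t \<in> N. sep_le t s \<or> (sep_le s (prod.swap t) \<and> prod.swap t \<noteq> s)}"
proof (intro equalityI subsetI)
  have sN: "s \<in> N" using s orientation_subset[OF \<sigma>] by blast
  fix t
  { assume t: "t \<in> \<sigma>"
    then have tN: "t \<in> N" using orientation_subset[OF \<sigma>] by blast
    have "\<not> sep_le (prod.swap t) s"
      using orientation_down[OF \<sigma> s swap[OF tN]] orientation_iff[OF \<sigma> tN] t by blast
    moreover have "prod.swap t \<noteq> s" using orientation_iff[OF \<sigma> tN] t s by auto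
    ultimately show "t \<in> {t \<in> N. sep_le t s \<or> (sep_le s (prod.swap t) \<and> prod.swap t \<noteq> s)}"
      using nested[OF tN sN] max[OF t] tN unfolding nested_iff
      by (auto simp: sep_le_swap_left sep_le_swap_right) }
  assume t: "t \<in> {t \<in> N. sep_le t s \<or> (sep_le s (prod.swap t) \<and> prod.swap t \<noteq> s)}"
  then show "t \<in> \<sigma>"
    using orientation_down[OF \<sigma> s] orientation_iff[OF \<sigma>] max by blast
qed

lemma ex_maximal_orientation:
  assumes sN: "s \<in> N"
  obtains \<sigma> where "\<sigma> \<in> orientations N" "s \<in> \<sigma>" "\<And>t. t \<in> \<sigma> \<Longrightarrow> sep_le s t \<Longrightarrow> t = s"
proof -
  let ?P = "{t \<in> N. sep_le t s \<or> (sep_le s (prod.swap t) \<and> prod.swap t \<noteq> s)}"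
  have "partial_orientation N ?P"
    unfolding partial_orientation_def
  proof (intro conjI ballI impI)
    show "?P \<subseteq> N" by blast
    fix t assume "t \<in> ?P"
    then consider "sep_le t s" | "sep_le s (prod.swap t)" "prod.swap t \<noteq> s" by blast
    then show "prod.swap t \<notin> ?P"
    proof cases
      case 1
      have "\<not> sep_le (prod.swap t) s"
        using 1 proper'[OF sN] sep_le_trans[of "prod.swap s" t s] by (auto simp: sep_le_swap_left)
      moreover have "t = s" if "sep_le s t" using sep_le_antisym[OF 1 that] .
      ultimately show ?thesis by auto
    next
      case 2
      have "\<not> sep_le s t"
        using 2 proper[OF sN] sep_le_trans[of s t "prod.swap s"] by (auto simp: sep_le_swap_right)
      moreover have "prod.swap t = s" if "sep_le (prod.swap t) s" using sep_le_antisym[OF that 2(1)] .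
      ultimately show ?thesis using 2(2) by auto
    qed
  next
    fix t u assume t: "t \<in> N" and u: "u \<in> ?P" and le: "sep_le t u"
    have le': "sep_le (prod.swap u) (prod.swap t)" using le by simp
    from u consider "sep_le u s" | "sep_le s (prod.swap u)" "prod.swap u \<noteq> s" by blast
    then show "t \<in> ?P"
    proof cases
      case 1 then show ?thesis using t sep_le_trans[OF le] by blast
    next
      case 2
      then have "prod.swap t \<noteq> s" using le' sep_le_antisym by blast
      then show ?thesis using t sep_le_trans[OF 2(1) le'] by blast
    qed
  qed
  then obtain \<sigma> where \<sigma>: "\<sigma> \<in> orientations N" "?P \<subseteq> \<sigma>"
    by (rule extend_partial_orientation)
  show ?thesis
  proof
    show "\<sigma> \<in> orientations N" by fact
    show "s \<in> \<sigma>" using \<sigma> sN by auto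
    fix t assume t: "t \<in> \<sigma>" "sep_le s t"
    then have tN: "t \<in> N" using orientation_subset[OF \<sigma>(1)] by blast
    show "t = s"
    proof (rule ccontr)
      assume "t \<noteq> s"
      then have "prod.swap t \<in> ?P" using t tN swap by auto
      then show False using \<sigma> orientation_iff[OF \<sigma>(1) tN] t by blast
    qed
  qed
qed

end


section \<open>The tree of orientations\<close>

context tree_set
begin

abbreviation T :: "nat pair_pre_digraph" where "T \<equiv> orientation_tree N"
abbreviation L :: "nat \<Rightarrow> ('a set \<times> 'a set) set" where "L \<equiv> orientation_at N"

lemma L_bij: "bij_betw L (pverts T) (orientations N)"
  unfolding orientation_tree_def orientation_at_def
  using bij_betw_from_nat_into_finite[OF finite_orientations] by simp

lemma L_orientation: "i \<in> pverts T \<Longrightarrow> L i \<in> orientations N"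
  using L_bij by (auto simp: bij_betw_def)

lemma L_inj: "i \<in> pverts T \<Longrightarrow> j \<in> pverts T \<Longrightarrow> L i = L j \<Longrightarrow> i = j"
  using L_bij by (auto simp: bij_betw_def inj_on_def)

lemma L_surj: "\<sigma> \<in> orientations N \<Longrightarrow> \<exists>i\<in>pverts T. L i = \<sigma>"
  using L_bij by (metis bij_betw_iff_bijections)

lemma arc_iff: "(i, j) \<in> parcs T \<longleftrightarrow> i \<in> pverts T \<and> j \<in> pverts T \<and> (\<exists>s. L i - L j = {s})"
  by (auto simp: orientation_tree_def)

lemma pair_graph_T: "pair_graph T"
proof -
  have sub: "parcs T \<subseteq> pverts T \<times> pverts T" by (auto simp: arc_iff)
  have fin: "finite (pverts T)" by (simp add: orientation_tree_def)
  have sym: "(j, i) \<in> parcs T" if ij: "(i, j) \<in> parcs T" for i j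
  proof -
    obtain s where s: "i \<in> pverts T" "j \<in> pverts T" "L i - L j = {s}"
      using ij unfolding arc_iff by blast
    then have "L j - L i = {prod.swap s}"
      using diff_swap[OF L_orientation[OF s(1)] L_orientation[OF s(2)]] by simp
    then show ?thesis using s by (auto simp: arc_iff)
  qed
  show ?thesis
  proof
    show "\<And>e. e \<in> parcs T \<Longrightarrow> fst e \<in> pverts T" "\<And>e. e \<in> parcs T \<Longrightarrow> snd e \<in> pverts T"
      using sub by auto
    show "finite (pverts T)" by fact
    show "finite (parcs T)" using finite_subset[OF sub] fin by blast
    show "\<And>e. e \<in> parcs T \<Longrightarrow> fst e \<noteq> snd e" by (auto simp: arc_iff)
    show "symmetric (with_proj T)"
      using sym by (auto simp: symmetric_def intro: symI)
  qed
qed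

text \<open>
  A shortest route from \<open>i\<close> to \<open>j\<close> flips only elements of \<open>L i - L j\<close>, one at a time and a
  maximal one first, so everything common to \<open>L i\<close> and \<open>L j\<close> is kept along the way. The
  set \<open>B\<close> makes this usable for branch sets as well as for the whole tree.
\<close>
lemma reachable_between:
  assumes "i \<in> pverts T" "j \<in> pverts T" "B \<subseteq> pverts T"
    and "\<And>k. k \<in> pverts T \<Longrightarrow> L i \<inter> L j \<subseteq> L k \<Longrightarrow> k \<in> B"
  shows "i \<rightarrow>\<^sup>*\<^bsub>with_proj T \<restriction> B\<^esub> j"
  using assms
proof (induction "card (L i - L j)" arbitrary: i rule: less_induct)
  case less
  interpret T: pair_graph T by (rule pair_graph_T)
  interpret B: wf_digraph "with_proj T \<restriction> B" by (rule T.wellformed_induce_subgraph)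
  note i = L_orientation[OF less.prems(1)] and j = L_orientation[OF less.prems(2)]
  have iB: "i \<in> B" using less.prems(1,4) by blast
  have fin: "Finite_Set.finite (L i - L j)"
    using orientation_subset[OF i] finite finite_subset by blast
  show ?case
  proof (cases "L i - L j = {}")
    case True
    then have "L i = L j" using orientation_eqI[OF i j] by blast
    then show ?thesis using L_inj[OF less.prems(1,2)] iB by auto
  next
    case False
    from ex_sep_maximal[OF fin this] obtain s where s: "s \<in> L i" "s \<notin> L j"
      and max: "\<forall>t\<in>L i - L j. sep_le s t \<longrightarrow> t = s" by blast
    have sN: "s \<in> N" using orientation_subset[OF i] s(1) by blast
    have max': "t = s" if "t \<in> L i" "sep_le s t" for t
    proof -
      have "t \<notin> L j" using orientation_down[OF j _ sN that(2)] s(2) by blast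
      then show ?thesis using max that by blast
    qed
    let ?\<tau> = "insert (prod.swap s) (L i - {s})"
    from L_surj[OF flip_maximal[OF i s(1) max']] obtain k where k: "k \<in> pverts T" "L k = ?\<tau>" by blast
    have sj: "prod.swap s \<in> L j" and si: "prod.swap s \<notin> L i"
      using orientation_iff[OF j sN] orientation_iff[OF i sN] s by blast+
    have diff: "L k - L j = (L i - L j) - {s}" unfolding k(2) using sj by auto
    have less: "card (L k - L j) < card (L i - L j)"
      unfolding diff using fin s by (intro psubset_card_mono) auto
    have inc: "L i \<inter> L j \<subseteq> L k \<inter> L j" using k s by blast
    have "k \<rightarrow>\<^sup>*\<^bsub>with_proj T \<restriction> B\<^esub> j"
      using inc less.prems(2,3,4) by (intro less.hyps[OF less k(1)]) blast+
    moreover have "L i - L k = {s}" using k s si swap_neq[OF sN] by auto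
    then have "(i, k) \<in> parcs T" using less.prems(1) k by (auto simp: arc_iff)
    moreover have "k \<in> B" using inc less.prems(4) k(1) by blast
    ultimately show ?thesis using iB
      by (intro B.adj_reachable_trans[of i k]) (auto simp: arcs_ends_conv intro!: rev_image_eqI)
  qed
qed

lemma connected_subtree:
  assumes "B \<subseteq> pverts T" "B \<noteq> {}"
    and "\<And>i j k. i \<in> B \<Longrightarrow> j \<in> B \<Longrightarrow> k \<in> pverts T \<Longrightarrow> L i \<inter> L j \<subseteq> L k \<Longrightarrow> k \<in> B"
  shows "Digraph_Component.connected (with_proj T \<restriction> B)"
proof -
  interpret T: pair_graph T by (rule pair_graph_T)
  interpret B: wf_digraph "with_proj T \<restriction> B" by (rule T.wellformed_induce_subgraph)
  show ?thesis
    unfolding connected_def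
  proof (rule strongly_connectedI)
    show "verts (with_proj (mk_symmetric (with_proj T \<restriction> B))) \<noteq> {}" using assms(2) by simp
    fix i j
    assume "i \<in> verts (with_proj (mk_symmetric (with_proj T \<restriction> B)))"
      "j \<in> verts (with_proj (mk_symmetric (with_proj T \<restriction> B)))"
    then have ij: "i \<in> B" "j \<in> B" by auto
    have "i \<rightarrow>\<^sup>*\<^bsub>with_proj T \<restriction> B\<^esub> j"
      using ij assms by (intro reachable_between) blast+
    then show "i \<rightarrow>\<^sup>*\<^bsub>with_proj (mk_symmetric (with_proj T \<restriction> B))\<^esub> j"
      by (rule B.reachable_mk_symmetricI)
  qed
qed

lemma orientations_nonempty: "orientations N \<noteq> {}"
  using extend_partial_orientation[of "{}"] by (auto simp: partial_orientation_def)

lemma connected_T: "Digraph_Component.connected (with_proj T)"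
proof -
  interpret T: pair_graph T by (rule pair_graph_T)
  have "with_proj T \<restriction> pverts T = with_proj T"
    using T.wellformed' by (auto simp: induce_subgraph_def with_proj_def)
  moreover have "pverts T \<noteq> {}" using orientations_nonempty L_surj by blast
  ultimately show ?thesis using connected_subtree[of "pverts T"] by auto
qed

text \<open>
  A walk that loses \<open>s\<close> uses the edge of \<open>s\<close>. Together with \<open>entering_arc\<close> and
  \<open>tail_unique\<close> this shows that a walk which loses \<open>s\<close> and regains it visits the same node
  twice.
\<close>
lemma leaving_arc:
  assumes "pre_digraph.awalk (with_proj T) u p v" "s \<in> L u" "s \<notin> L v"
  shows "\<exists>x y. (x, y) \<in> set p \<and> L x - L y = {s}"
proof -
  interpret T: pair_graph T by (rule pair_graph_T)
  show ?thesis using assms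
  proof (induction p arbitrary: u)
    case Nil
    then show ?case by (auto simp: T.awalk_Nil_iff)
  next
    case (Cons e p)
    obtain y where e: "e = (u, y)" "(u, y) \<in> parcs T" "T.awalk y p v"
      using Cons.prems(1) by (cases e) (auto simp: T.awalk_Cons_iff)
    show ?case
    proof (cases "s \<in> L y")
      case True
      then show ?thesis using Cons.IH[OF e(3)] Cons.prems(3) by auto
    next
      case False
      obtain s' where s': "L u - L y = {s'}" using e(2) unfolding arc_iff by blast
      have "s \<in> L u - L y" using False Cons.prems(2) by blast
      then have "s' = s" unfolding s' by blast
      then show ?thesis using e(1) s' by auto
    qed
  qed
qed

lemma entering_arc:
  assumes p: "pre_digraph.awalk (with_proj T) u p v" and s: "s \<notin> L u" "s \<in> L v"
  shows "\<exists>x y. (y, x) \<in> set p \<and> L x - L y = {s}"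
proof -
  interpret T: pair_graph T by (rule pair_graph_T)
  note u = L_orientation[OF T.awalk_hd_in_verts[OF p]]
  note v = L_orientation[OF T.awalk_last_in_verts[OF p]]
  have sN: "s \<in> N" using s(2) orientation_subset[OF v] by blast
  have "prod.swap s \<in> L u" "prod.swap s \<notin> L v"
    using orientation_iff[OF u sN] orientation_iff[OF v sN] s by blast+
  from leaving_arc[OF p this] obtain x y where xy: "(x, y) \<in> set p" "L x - L y = {prod.swap s}"
    by blast
  have "(x, y) \<in> parcs T" using p xy(1) by (auto simp: T.awalk_def)
  then have "L y - L x = {s}"
    using diff_swap[OF L_orientation L_orientation, of x y] xy(2) unfolding arc_iff by simp
  then show ?thesis using xy(1) by blast
qed

lemma tail_unique:
  assumes "(x, y) \<in> parcs T" "(x', y') \<in> parcs T" "L x - L y = {s}" "L x' - L y' = {s}"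
  shows "x = x'"
proof -
  have v: "x \<in> pverts T" "y \<in> pverts T" "x' \<in> pverts T" "y' \<in> pverts T"
    using assms by (auto simp: arc_iff)
  have s: "s \<in> L x" "s \<in> L x'" using assms by blast+
  have "L x = L x'"
    using maximal_orientation_eq[OF L_orientation[OF v(1)] s(1)
        diff_singleton_maximal(1)[OF L_orientation[OF v(1)] L_orientation[OF v(2)] assms(3)]]
      maximal_orientation_eq[OF L_orientation[OF v(3)] s(2)
        diff_singleton_maximal(1)[OF L_orientation[OF v(3)] L_orientation[OF v(4)] assms(4)]]
    by simp
  then show ?thesis using L_inj v by blast
qed

lemma path_between:
  assumes p: "pre_digraph.apath (with_proj T) u p v"
    and w: "w \<in> set (pre_digraph.awalk_verts (with_proj T) u p)"
  shows "L u \<inter> L v \<subseteq> L w"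
proof
  interpret T: pair_graph T by (rule pair_graph_T)
  fix s assume s: "s \<in> L u \<inter> L v"
  show "s \<in> L w"
  proof (rule ccontr)
    assume ns: "s \<notin> L w"
    have p': "T.awalk u p v" using p by (rule T.awalkI_apath)
    have "\<exists>q r. p = q @ r \<and> T.awalk u q w \<and> T.awalk w r v"
      by (rule T.awalk_decomp[OF p']) (use w in simp)
    then obtain q r where qr: "p = q @ r" "T.awalk u q w" "T.awalk w r v"
      by blast
    obtain x y where xy: "(x, y) \<in> set q" "L x - L y = {s}"
      using leaving_arc[OF qr(2)] s ns by blast
    obtain x' y' where xy': "(y', x') \<in> set r" "L x' - L y' = {s}"
      using entering_arc[OF qr(3)] s ns by blast
    have "(x, y) \<in> parcs T" "(y', x') \<in> parcs T"
      using qr xy(1) xy'(1) by (auto simp: T.awalk_def)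
    then have "x = x'" using tail_unique[OF _ _ xy(2) xy'(2)] T.arcs_symmetric by blast
    have 1: "x \<in> set (pawalk_verts u q)"
      using T.awalk_verts_arc1[OF xy(1), of u] by simp
    have "pawalk_verts w r = fst (hd r) # map snd r"
      using T.awalk_verts_conv'[of w r v] qr(3) xy'(1) by (auto simp: T.awalk_def)
    then have 2: "x \<in> set (tl (pawalk_verts w r))"
      using xy'(1) \<open>x = x'\<close> by force
    have "last (pawalk_verts u q) = w" using T.awlast_of_awalk[OF qr(2)] by simp
    then show False using T.apath_decomp_disjoint[OF p qr(1) 1] 2 by simp
  qed
qed

text \<open>
  An edge of a cycle joins two nodes whose orientations differ only in one \<open>s\<close>. By
  \<open>path_between\<close> every node on the rest of the cycle contains their intersection, and it
  must contain \<open>s\<close> or its reversal, so it is one of the two ends. Hence a cycle has length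
  at most 2.
\<close>
theorem undirected_tree_T: "undirected_tree T"
proof -
  interpret T: pair_graph T by (rule pair_graph_T)
  have False if cyc: "T.cycle p" and len: "3 \<le> length p" for p
  proof -
    obtain u where u: "T.awalk u p u" "distinct (tl (pawalk_verts u p))"
      using cyc by (auto simp: T.cycle_def)
    obtain e1 e2 q where pq: "p = e1 # e2 # q" "q \<noteq> []"
      using len by (auto simp: numeral_3_eq_3 Suc_le_length_iff)
    obtain w x where e: "e1 = (u, w)" "e2 = (w, x)" "(u, w) \<in> parcs T" "T.awalk w (e2 # q) u"
      using u(1) unfolding pq(1) by (cases e1; cases e2) (auto simp: T.awalk_Cons_iff)
    have path: "T.apath w (e2 # q) u"
      using e u(2) by (auto simp: T.apath_def pq(1))
    have xq: "T.apath x q u" "w \<notin> set (pawalk_verts x q)"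
      using path by (auto simp: T.apath_Cons_iff e(2))
    have "x \<noteq> u" using T.apath_nonempty_ends[OF xq(1) pq(2)] .
    have x: "x \<in> set (pawalk_verts x q)" using T.hd_in_awalk_verts(2)[OF xq(1)] by simp
    then have "x \<noteq> w" using xq(2) by blast
    have sub: "L w \<inter> L u \<subseteq> L x"
      using path_between[OF path, of x] x by (simp add: e(2))
    obtain s where s: "L u - L w = {s}" using e(3) unfolding arc_iff by blast
    have v: "u \<in> pverts T" "w \<in> pverts T" "x \<in> pverts T"
      using e(3) xq(1) by (auto simp: arc_iff T.apath_def dest: T.awalk_hd_in_verts)
    note Lu = L_orientation[OF v(1)] and Lw = L_orientation[OF v(2)] and Lx = L_orientation[OF v(3)]
    have sN: "s \<in> N" using s orientation_subset[OF Lu] by blast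
    have wu: "L w = insert (prod.swap s) (L u - {s})"
      by (rule diff_singleton_maximal(2)[OF Lu Lw s])
    have "L u \<subseteq> L x \<or> L w \<subseteq> L x"
    proof (cases "s \<in> L x")
      case True
      moreover have "y \<in> L x" if "y \<in> L u" "y \<noteq> s" for y
      proof -
        have "y \<notin> L u - L w" unfolding s using that(2) by simp
        then show ?thesis using sub that(1) by blast
      qed
      ultimately have "L u \<subseteq> L x" by blast
      then show ?thesis ..
    next
      case False
      then have "prod.swap s \<in> L x" using orientation_iff[OF Lx sN] by blast
      moreover have "L u - {s} \<subseteq> L x" using sub unfolding wu by blast
      ultimately have "L w \<subseteq> L x" unfolding wu by blast
      then show ?thesis ..
    qed
    then have "L u = L x \<or> L w = L x"
      using orientation_eqI[OF Lu Lx] orientation_eqI[OF Lw Lx] by blast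
    then show False using L_inj v \<open>x \<noteq> u\<close> \<open>x \<noteq> w\<close> by blast
  qed
  then show ?thesis
    unfolding undirected_tree_def using pair_graph_T connected_T by blast
qed

section \<open>The tree-decomposition\<close>

text \<open>
  The orientations towards \<open>U\<close> are compatible with \<open>P\<close> because \<open>U\<close> lies in the part of
  \<open>P\<close>. With \<open>P\<close> empty the lemma yields a part containing a vertex or an edge, with \<open>U\<close>
  empty an extension of \<open>P\<close>, and with both a part of a finer decomposition that contains a
  given vertex of a coarser part.
\<close>
lemma extend_through:
  assumes P: "P \<subseteq> N" "\<And>s t. s \<in> P \<Longrightarrow> t \<in> P \<Longrightarrow> \<not> sep_le (prod.swap s) t"
    and U: "U \<subseteq> part_of V P" "\<And>s. s \<in> N \<Longrightarrow> U \<subseteq> fst s \<or> U \<subseteq> snd s"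
  obtains \<sigma> where "\<sigma> \<in> orientations N" "P \<subseteq> \<sigma>" "U \<subseteq> part_of V \<sigma>"
proof -
  \<comment> \<open>These separations must point towards \<open>U\<close>; those with \<open>U\<close> in the separator are free.\<close>
  let ?F = "{s \<in> N. \<not> U \<subseteq> fst s}"
  let ?Q = "{s \<in> N. \<exists>t \<in> P \<union> ?F. sep_le s t}"
  have snd: "U \<subseteq> snd s" if "s \<in> P \<union> ?F" for s
    using that
  proof
    assume "s \<in> P"
    then show ?thesis using U(1) by (auto simp: part_of_def)
  next
    assume "s \<in> ?F"
    then show ?thesis using U(2)[of s] by blast
  qed
  have away: "\<not> sep_le (prod.swap s) t" if "s \<in> P \<union> ?F" "t \<in> P \<union> ?F" for s t
  proof
    assume le: "sep_le (prod.swap s) t"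
    then have le': "sep_le (prod.swap t) s" by (simp add: sep_le_swap_left)
    have "U \<subseteq> fst t" using le snd[OF that(1)] by (cases s; cases t) auto
    moreover have "U \<subseteq> fst s" using le' snd[OF that(2)] by (cases s; cases t) auto
    ultimately show False using that P(2) le by blast
  qed
  have "partial_orientation N ?Q"
    unfolding partial_orientation_def
  proof (intro conjI ballI impI)
    fix s assume s: "s \<in> ?Q"
    show "prod.swap s \<notin> ?Q"
    proof
      assume "prod.swap s \<in> ?Q"
      with s obtain t t' where t: "t \<in> P \<union> ?F" "sep_le s t" "t' \<in> P \<union> ?F" "sep_le (prod.swap s) t'"
        by blast
      have "sep_le (prod.swap t) (prod.swap s)" using t(2) by simp
      then show False using sep_le_trans t(4) away[OF t(1,3)] by blast
    qed
  next
    fix s t assume "s \<in> N" "t \<in> ?Q" "sep_le s t"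
    then show "s \<in> ?Q" using sep_le_trans by blast
  qed blast
  then obtain \<sigma> where \<sigma>: "\<sigma> \<in> orientations N" "?Q \<subseteq> \<sigma>" by (rule extend_partial_orientation)
  have sub: "P \<union> ?F \<subseteq> \<sigma>" using \<sigma>(2) P(1) sep_le_refl by blast
  have "U \<subseteq> snd s" if s: "s \<in> \<sigma>" for s
  proof (rule ccontr)
    assume n: "\<not> U \<subseteq> snd s"
    have sN: "s \<in> N" using s orientation_subset[OF \<sigma>(1)] by blast
    have "fst (prod.swap s) = snd s" by (cases s) auto
    then have "prod.swap s \<in> \<sigma>" using n sub swap[OF sN] by (auto simp del: fst_swap)
    then show False using orientation_iff[OF \<sigma>(1) sN] s by blast
  qed
  then have "U \<subseteq> part_of V \<sigma>" using U(1) by (auto simp: part_of_def)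
  then show ?thesis using that \<sigma>(1) sub by blast
qed

lemma ex_node_through:
  assumes "U \<subseteq> V" "\<And>s. s \<in> N \<Longrightarrow> U \<subseteq> fst s \<or> U \<subseteq> snd s"
  shows "\<exists>i\<in>pverts T. U \<subseteq> part_of V (L i)"
proof -
  have U: "U \<subseteq> part_of V {}" using assms(1) by (simp add: part_of_def)
  obtain \<sigma> where "\<sigma> \<in> orientations N" "U \<subseteq> part_of V \<sigma>"
    by (rule extend_through[OF _ _ U assms(2)]) simp_all
  then show ?thesis using L_surj by blast
qed

text \<open>
  A set that is not contained in any separator of \<open>N\<close> lies on exactly one side of each
  separation, so it prescribes the whole orientation.
\<close>
lemma unique_node_through:
  assumes "U \<subseteq> V" "\<And>s. s \<in> N \<Longrightarrow> U \<subseteq> fst s \<or> U \<subseteq> snd s"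
    and small: "\<And>s. s \<in> N \<Longrightarrow> \<not> U \<subseteq> fst s \<inter> snd s"
  shows "\<exists>!i. i \<in> pverts T \<and> U \<subseteq> part_of V (L i)"
proof -
  have char: "L i = {s \<in> N. U \<subseteq> snd s}" if i: "i \<in> pverts T" "U \<subseteq> part_of V (L i)" for i
  proof -
    note Li = L_orientation[OF i(1)]
    have 1: "U \<subseteq> snd s" if "s \<in> L i" for s using that i(2) by (auto simp: part_of_def)
    have "s \<in> L i" if s: "s \<in> N" "U \<subseteq> snd s" for s
    proof (rule ccontr)
      assume "s \<notin> L i"
      then have "U \<subseteq> snd (prod.swap s)" using orientation_iff[OF Li s(1)] 1 by blast
      then show False using small[OF s(1)] s(2) by (auto simp: snd_swap)
    qed
    then show ?thesis using 1 orientation_subset[OF Li] by blast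
  qed
  obtain i where i: "i \<in> pverts T" "U \<subseteq> part_of V (L i)" using ex_node_through[OF assms(1,2)] by blast
  have "j = i" if "j \<in> pverts T" "U \<subseteq> part_of V (L j)" for j
    by (rule L_inj[OF that(1) i(1) trans[OF char[OF that] char[OF i, symmetric]]])
  then show ?thesis using i by blast
qed

lemma tree_decomposition_T:
  assumes G: "pair_graph G"
    and sep: "\<And>s. s \<in> N \<Longrightarrow> fst s \<union> snd s = pverts G"
      "\<And>s u v. s \<in> N \<Longrightarrow> (u, v) \<in> parcs G \<Longrightarrow> {u, v} \<subseteq> fst s \<or> {u, v} \<subseteq> snd s"
  shows "tree_decomposition G T (\<lambda>i. part_of (pverts G) (L i))"
  unfolding tree_decomposition_def
proof (intro conjI)
  interpret G: pair_graph G by fact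
  show "undirected_tree T" by (rule undirected_tree_T)
  show "(\<Union>i\<in>pverts T. part_of (pverts G) (L i)) = pverts G"
  proof
    show "(\<Union>i\<in>pverts T. part_of (pverts G) (L i)) \<subseteq> pverts G" by (auto simp: part_of_def)
    show "pverts G \<subseteq> (\<Union>i\<in>pverts T. part_of (pverts G) (L i))"
    proof
      fix v assume "v \<in> pverts G"
      then show "v \<in> (\<Union>i\<in>pverts T. part_of (pverts G) (L i))"
        using ex_node_through[of "{v}" "pverts G"] sep(1) by blast
    qed
  qed
  show "\<forall>(u, v)\<in>parcs G. \<exists>t\<in>pverts T. u \<in> part_of (pverts G) (L t) \<and> v \<in> part_of (pverts G) (L t)"
  proof (clarify)
    fix u v assume uv: "(u, v) \<in> parcs G"
    then have "{u, v} \<subseteq> pverts G" using G.wellformed' by blast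
    from ex_node_through[OF this sep(2)[OF _ uv]]
    show "\<exists>t\<in>pverts T. u \<in> part_of (pverts G) (L t) \<and> v \<in> part_of (pverts G) (L t)" by blast
  qed
  show "\<forall>t1 p t3. pre_digraph.apath (with_proj T) t1 p t3 \<longrightarrow>
      (\<forall>t2\<in>set (pre_digraph.awalk_verts (with_proj T) t1 p).
        part_of (pverts G) (L t1) \<inter> part_of (pverts G) (L t3) \<subseteq> part_of (pverts G) (L t2))"
  proof (intro allI impI ballI)
    fix i p j k
    assume p: "pre_digraph.apath (with_proj T) i p j"
      and k: "k \<in> set (pre_digraph.awalk_verts (with_proj T) i p)"
    interpret T: pair_graph T by (rule pair_graph_T)
    have aw: "T.awalk i p j" using p by (rule T.awalkI_apath)
    have v: "i \<in> pverts T" "j \<in> pverts T" "k \<in> pverts T"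
      using T.awalk_hd_in_verts[OF aw] T.awalk_last_in_verts[OF aw] k aw
      by (auto elim!: T.awalkE')
    note or = v[THEN L_orientation]
    have "L k \<subseteq> L i \<union> L j"
    proof
      fix s assume s: "s \<in> L k"
      then have sN: "s \<in> N" using orientation_subset[OF or(3)] by blast
      show "s \<in> L i \<union> L j"
      proof (rule ccontr)
        assume "s \<notin> L i \<union> L j"
        then have "prod.swap s \<in> L i \<inter> L j"
          using orientation_iff[OF or(1) sN] orientation_iff[OF or(2) sN] by simp
        then have "prod.swap s \<in> L k" using path_between[OF p k] by (rule rev_subsetD)
        then show False using orientation_iff[OF or(3) sN] s by simp
      qed
    qed
    then show "part_of (pverts G) (L i) \<inter> part_of (pverts G) (L j) \<subseteq> part_of (pverts G) (L k)"
      by (auto simp: part_of_def)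
  qed
qed

lemma adhesion_T:
  assumes V: "Finite_Set.finite V" and k: "\<And>s. s \<in> N \<Longrightarrow> card (fst s \<inter> snd s) \<le> k"
    and sub: "\<And>s. s \<in> N \<Longrightarrow> fst s \<union> snd s \<subseteq> V"
  shows "adhesion T (\<lambda>i. part_of V (L i)) \<le> k"
proof -
  interpret T: pair_graph T by (rule pair_graph_T)
  have le: "card (part_of V (L i) \<inter> part_of V (L j)) \<le> k" if ij: "(i, j) \<in> parcs T" for i j
  proof -
    obtain s where s: "i \<in> pverts T" "j \<in> pverts T" "L i - L j = {s}"
      using ij unfolding arc_iff by blast
    note Li = L_orientation[OF s(1)] and Lj = L_orientation[OF s(2)]
    have sN: "s \<in> N" using s orientation_subset[OF Li] by blast
    have "s \<in> L i" "prod.swap s \<in> L j" using s orientation_iff[OF Lj sN] by blast+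
    then have "part_of V (L i) \<subseteq> snd s" "part_of V (L j) \<subseteq> snd (prod.swap s)"
      unfolding part_of_def by blast+
    then have "part_of V (L i) \<inter> part_of V (L j) \<subseteq> fst s \<inter> snd s"
      by auto
    moreover have "Finite_Set.finite (fst s \<inter> snd s)" using sub[OF sN] V finite_subset by blast
    ultimately show ?thesis using card_mono k[OF sN] le_trans by blast
  qed
  have eq: "{card (part_of V (L t) \<inter> part_of V (L t')) |t t'. (t, t') \<in> parcs T}
      = (\<lambda>(t, t'). card (part_of V (L t) \<inter> part_of V (L t'))) ` parcs T" by auto
  have "Finite_Set.finite {card (part_of V (L t) \<inter> part_of V (L t')) |t t'. (t, t') \<in> parcs T}"
    unfolding eq using T.pair_finite_arcs by simp
  then show ?thesis unfolding adhesion_def using le by auto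
qed

end


section \<open>Refining the tree\<close>

lemma restrict_orientation:
  assumes "N0 \<subseteq> N" "\<And>s. s \<in> N0 \<Longrightarrow> prod.swap s \<in> N0" "\<sigma> \<in> orientations N"
  shows "\<sigma> \<inter> N0 \<in> orientations N0"
  using assms unfolding orientations_def partial_orientation_def by blast

text \<open>
  The branch set of a node of the coarse tree consists of the orientations that extend it.
  The edge of a separation \<open>s\<close> of \<open>N0\<close> in the coarse tree comes from the edge of \<open>s\<close> in
  the fine one, since the orientation in which \<open>s\<close> is maximal restricts to the one in
  which \<open>s\<close> is maximal.
\<close>
theorem td_le_orientation_trees:
  assumes "tree_set N0" "tree_set N" "N0 \<subseteq> N"
    and sides: "\<And>s. s \<in> N \<Longrightarrow> fst s \<union> snd s = V"
  shows "td_le (orientation_tree N0) (\<lambda>i. part_of V (orientation_at N0 i))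
    (orientation_tree N) (\<lambda>i. part_of V (orientation_at N i))"
proof -
  interpret M: tree_set N0 by fact
  interpret N: tree_set N by fact
  have restrict: "\<sigma> \<inter> N0 \<in> orientations N0" if "\<sigma> \<in> orientations N" for \<sigma>
    using restrict_orientation[OF assms(3) M.swap that] by blast
  define B where "B i = {j \<in> pverts N.T. N.L j \<inter> N0 = M.L i}" for i
  have BI: "j \<in> B i" if "i \<in> pverts M.T" "j \<in> pverts N.T" "M.L i \<subseteq> N.L j" for i j
  proof -
    have "M.L i \<subseteq> N.L j \<inter> N0"
      using that(3) M.orientation_subset[OF M.L_orientation[OF that(1)]] by blast
    from M.orientation_eqI[OF M.L_orientation[OF that(1)] restrict[OF N.L_orientation[OF that(2)]] this]
    show ?thesis using that(2) by (simp add: B_def)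
  qed
  have away: "\<not> sep_le (prod.swap s) t" if i: "i \<in> pverts M.T" and st: "s \<in> M.L i" "t \<in> M.L i" for i s t
  proof
    note Li = M.L_orientation[OF i]
    assume "sep_le (prod.swap s) t"
    moreover have sN: "s \<in> N0" using st(1) M.orientation_subset[OF Li] by blast
    ultimately have "prod.swap s \<in> M.L i" using M.orientation_down[OF Li st(2) M.swap] by blast
    then show False using M.orientation_iff[OF Li sN] st(1) by simp
  qed
  have lift: "\<exists>j\<in>B i. U \<subseteq> part_of V (N.L j)"
    if i: "i \<in> pverts M.T" and U: "U \<subseteq> part_of V (M.L i)"
      and inN: "\<And>s. s \<in> N \<Longrightarrow> U \<subseteq> fst s \<or> U \<subseteq> snd s" for i U
  proof -
    have sub: "M.L i \<subseteq> N" using M.orientation_subset[OF M.L_orientation[OF i]] assms(3) by blast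
    obtain \<sigma> where \<sigma>: "\<sigma> \<in> orientations N" "M.L i \<subseteq> \<sigma>" "U \<subseteq> part_of V \<sigma>"
      by (rule N.extend_through[OF sub away[OF i] U inN])
    from N.L_surj[OF \<sigma>(1)] obtain j where "j \<in> pverts N.T" "N.L j = \<sigma>" by blast
    then show ?thesis using BI[OF i] \<sigma> by blast
  qed
  have "minor_model M.T N.T B"
    unfolding minor_model_def
  proof (intro conjI ballI)
    fix i assume i: "i \<in> pverts M.T"
    show BT: "B i \<subseteq> pverts N.T" by (auto simp: B_def)
    have "B i \<noteq> {}" using lift[OF i, of "{}"] by auto
    moreover have "k \<in> B i"
      if "a \<in> B i" "b \<in> B i" "k \<in> pverts N.T" "N.L a \<inter> N.L b \<subseteq> N.L k" for a b k
    proof (rule BI[OF i that(3)])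
      have "M.L i \<subseteq> N.L a" "M.L i \<subseteq> N.L b" using that(1,2) by (auto simp: B_def)
      then show "M.L i \<subseteq> N.L k" using that(4) by blast
    qed
    ultimately show "Digraph_Component.connected (with_proj N.T \<restriction> B i)"
      using N.connected_subtree[OF BT] by blast
  next
    fix i j assume "i \<in> pverts M.T" "j \<in> pverts M.T"
    then show "i \<noteq> j \<longrightarrow> B i \<inter> B j = {}" using M.L_inj[of i j] by (auto simp: B_def)
  next
    fix e assume "e \<in> parcs M.T"
    then obtain i j s where e: "e = (i, j)" "i \<in> pverts M.T" "j \<in> pverts M.T" "M.L i - M.L j = {s}"
      using M.arc_iff by (cases e) blast
    note Li = M.L_orientation[OF e(2)] and Lj = M.L_orientation[OF e(3)]
    have s: "s \<in> M.L i" using e(4) by blast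
    have sN0: "s \<in> N0" using s M.orientation_subset[OF Li] by blast
    then have sN: "s \<in> N" using assms(3) by blast
    obtain \<sigma> where \<sigma>: "\<sigma> \<in> orientations N" "s \<in> \<sigma>"
      and max: "\<And>t. t \<in> \<sigma> \<Longrightarrow> sep_le s t \<Longrightarrow> t = s"
      using N.ex_maximal_orientation[OF sN] by metis
    let ?\<tau> = "insert (prod.swap s) (\<sigma> - {s})"
    have s\<sigma>: "s \<in> \<sigma> \<inter> N0" and max0: "\<And>t. t \<in> \<sigma> \<inter> N0 \<Longrightarrow> sep_le s t \<Longrightarrow> t = s"
      using \<sigma>(2) sN0 max by auto
    have eq: "\<sigma> \<inter> N0 = M.L i"
      using M.maximal_orientation_eq[OF restrict[OF \<sigma>(1)] s\<sigma> max0]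
        M.maximal_orientation_eq[OF Li s M.diff_singleton_maximal(1)[OF Li Lj e(4)]] by simp
    have "?\<tau> \<inter> N0 = insert (prod.swap s) (\<sigma> \<inter> N0 - {s})" using M.swap[OF sN0] by auto
    then have eq': "?\<tau> \<inter> N0 = M.L j"
      unfolding eq using M.diff_singleton_maximal(2)[OF Li Lj e(4)] by simp
    obtain u where u: "u \<in> pverts N.T" "N.L u = \<sigma>" using N.L_surj[OF \<sigma>(1)] by blast
    obtain v where v: "v \<in> pverts N.T" "N.L v = ?\<tau>"
      using N.L_surj[OF N.flip_maximal[OF \<sigma> max]] by blast
    have "s \<noteq> prod.swap s" using N.swap_neq[OF sN] by metis
    then have "N.L u - N.L v = {s}" unfolding u v using \<sigma>(2) N.orientation_iff[OF \<sigma>(1) sN] by auto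
    then have "(u, v) \<in> parcs N.T" using u v N.arc_iff by blast
    moreover have "u \<in> B i" "v \<in> B j" using u v eq eq' by (auto simp: B_def)
    ultimately show "case e of (x, y) \<Rightarrow> \<exists>u\<in>B x. \<exists>v\<in>B y. (u, v) \<in> parcs N.T"
      unfolding e(1) by auto
  qed
  moreover have "part_of V (M.L i) = (\<Union>j\<in>B i. part_of V (N.L j))" if i: "i \<in> pverts M.T" for i
  proof
    show "part_of V (M.L i) \<subseteq> (\<Union>j\<in>B i. part_of V (N.L j))"
    proof
      fix v assume v: "v \<in> part_of V (M.L i)"
      have "\<exists>j\<in>B i. {v} \<subseteq> part_of V (N.L j)"
      proof (rule lift[OF i])
        show "{v} \<subseteq> part_of V (M.L i)" using v by simp
        fix s assume "s \<in> N"
        from sides[OF this] show "{v} \<subseteq> fst s \<or> {v} \<subseteq> snd s"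
          using v by (auto simp: part_of_def)
      qed
      then show "v \<in> (\<Union>j\<in>B i. part_of V (N.L j))" by blast
    qed
    show "(\<Union>j\<in>B i. part_of V (N.L j)) \<subseteq> part_of V (M.L i)"
    proof
      fix v assume "v \<in> (\<Union>j\<in>B i. part_of V (N.L j))"
      then obtain j where j: "j \<in> B i" "v \<in> part_of V (N.L j)" by blast
      have "M.L i \<subseteq> N.L j" using j(1) unfolding B_def by blast
      then show "v \<in> part_of V (M.L i)" using j(2) by (auto simp: part_of_def)
    qed
  qed
  ultimately show ?thesis unfolding td_le_def by blast
qed

section \<open>The action of automorphisms\<close>

definition sep_image :: "('a \<Rightarrow> 'a) \<Rightarrow> 'a set \<times> 'a set \<Rightarrow> 'a set \<times> 'a set" where
  "sep_image \<alpha> s = (\<alpha> ` fst s, \<alpha> ` snd s)"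

lemma swap_sep_image: "prod.swap (sep_image \<alpha> s) = sep_image \<alpha> (prod.swap s)"
  by (simp add: sep_image_def)

lemma sep_image_inj:
  assumes "inj_on \<alpha> V"
  shows "inj_on (sep_image \<alpha>) (Pow V \<times> Pow V)"
proof (rule inj_onI)
  fix s t assume st: "s \<in> Pow V \<times> Pow V" "t \<in> Pow V \<times> Pow V" "sep_image \<alpha> s = sep_image \<alpha> t"
  have "fst s = fst t" "snd s = snd t"
    using st inj_on_image_eq_iff[OF assms, of "fst s" "fst t"]
      inj_on_image_eq_iff[OF assms, of "snd s" "snd t"] by (auto simp: sep_image_def)
  then show "s = t" by (rule prod_eqI)
qed

lemma inj_on_image_subset_cancel:
  assumes "inj_on f C" "A \<subseteq> C" "B \<subseteq> C"
  shows "f ` A \<subseteq> f ` B \<longleftrightarrow> A \<subseteq> B"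
proof
  assume "f ` A \<subseteq> f ` B"
  then show "A \<subseteq> B" using inj_on_image_mem_iff[OF assms(1) _ assms(3)] assms(2) by blast
qed blast

lemma sep_le_sep_image:
  assumes "inj_on \<alpha> V" "s \<in> Pow V \<times> Pow V" "t \<in> Pow V \<times> Pow V"
  shows "sep_le (sep_image \<alpha> s) (sep_image \<alpha> t) \<longleftrightarrow> sep_le s t"
  using assms inj_on_image_subset_cancel[OF assms(1), of "fst s" "fst t"]
    inj_on_image_subset_cancel[OF assms(1), of "snd t" "snd s"]
  by (cases s; cases t) (auto simp: sep_image_def)

lemma nested_sep_image:
  assumes "inj_on \<alpha> V" "s \<in> Pow V \<times> Pow V" "t \<in> Pow V \<times> Pow V"
  shows "nested (sep_image \<alpha> s) (sep_image \<alpha> t) \<longleftrightarrow> nested s t"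
proof -
  have "prod.swap t \<in> Pow V \<times> Pow V" using assms(3) by (cases t) auto
  then show ?thesis
    unfolding nested_iff swap_sep_image using sep_le_sep_image[OF assms(1)] assms(2,3) by simp
qed

lemma part_of_sep_image:
  assumes "bij_betw \<alpha> V V" "\<sigma> \<subseteq> Pow V \<times> Pow V"
  shows "part_of V (sep_image \<alpha> ` \<sigma>) = \<alpha> ` part_of V \<sigma>"
proof -
  have inj: "inj_on \<alpha> V" and im: "\<alpha> ` V = V" using assms(1) by (auto simp: bij_betw_def)
  have iff: "\<alpha> w \<in> snd (sep_image \<alpha> s) \<longleftrightarrow> w \<in> snd s" if "w \<in> V" "s \<in> \<sigma>" for w s
  proof -
    have "s \<in> Pow V \<times> Pow V" using that(2) assms(2) by blast
    then have "snd s \<subseteq> V" by (simp add: mem_Times_iff)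
    then show ?thesis using inj_on_image_mem_iff[OF inj that(1)] by (simp add: sep_image_def)
  qed
  show ?thesis
  proof (intro equalityI subsetI)
    fix v assume v: "v \<in> part_of V (sep_image \<alpha> ` \<sigma>)"
    then have "v \<in> \<alpha> ` V" using im by (simp add: part_of_def)
    then obtain w where w: "w \<in> V" "v = \<alpha> w" by blast
    then have "w \<in> part_of V \<sigma>" using v iff by (auto simp: part_of_def)
    then show "v \<in> \<alpha> ` part_of V \<sigma>" using w by blast
  next
    fix v assume "v \<in> \<alpha> ` part_of V \<sigma>"
    then obtain w where w: "w \<in> part_of V \<sigma>" "v = \<alpha> w" by blast
    moreover have "\<alpha> w \<in> V" using w im by (auto simp: part_of_def)
    ultimately show "v \<in> part_of V (sep_image \<alpha> ` \<sigma>)" using iff by (auto simp: part_of_def)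
  qed
qed

lemma sep_image_compose:
  assumes "s \<in> Pow V \<times> Pow V"
  shows "sep_image (compose V \<alpha> \<beta>) s = sep_image \<alpha> (sep_image \<beta> s)"
proof -
  have "compose V \<alpha> \<beta> ` A = \<alpha> ` \<beta> ` A" if "A \<subseteq> V" for A
    using that by (auto simp: image_image compose_def intro!: image_cong)
  then show ?thesis using assms by (auto simp: sep_image_def mem_Times_iff)
qed

lemma carrier_GraphAut [simp]: "carrier (GraphAut H) = graph_auto H"
  by (simp add: GraphAut_def)

lemma mult_GraphAut:
  assumes "\<alpha> \<in> graph_auto H" "\<beta> \<in> graph_auto H"
  shows "\<alpha> \<otimes>\<^bsub>GraphAut H\<^esub> \<beta> = compose (pverts H) \<alpha> \<beta>"
  using assms by (simp add: GraphAut_def BijGroup_def graph_auto_def)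

lemma compose_graph_auto:
  assumes "\<alpha> \<in> graph_auto H" "\<beta> \<in> graph_auto H"
  shows "compose (pverts H) \<alpha> \<beta> \<in> graph_auto H"
proof -
  have "\<alpha> \<in> Bij (pverts H)" "\<beta> \<in> Bij (pverts H)" using assms by (auto simp: graph_auto_def)
  moreover have "\<beta> v \<in> pverts H" if "v \<in> pverts H" for v
    using calculation(2) Bij_imp_funcset that by blast
  ultimately show ?thesis
    using assms by (auto simp: graph_auto_def compose_Bij compose_eq)
qed

context tree_set
begin

lemma sep_image_orientation:
  assumes NV: "N \<subseteq> Pow V \<times> Pow V" and inj: "inj_on \<alpha> V" and inv: "sep_image \<alpha> ` N \<subseteq> N"
    and \<sigma>: "\<sigma> \<in> orientations N"
  shows "sep_image \<alpha> ` \<sigma> \<in> orientations N"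
proof -
  have injN: "inj_on (sep_image \<alpha>) N" using inj_on_subset[OF sep_image_inj[OF inj] NV] .
  have surj: "sep_image \<alpha> ` N = N" using endo_inj_surj[OF finite inv injN] .
  have sub: "\<sigma> \<subseteq> N" by (rule orientation_subset[OF \<sigma>])
  have mem: "sep_image \<alpha> s \<in> sep_image \<alpha> ` \<sigma> \<longleftrightarrow> s \<in> \<sigma>" if "s \<in> N" for s
    using inj_on_image_mem_iff[OF injN that sub] .
  show ?thesis
  proof (rule orientationI)
    show "sep_image \<alpha> ` \<sigma> \<subseteq> N" using sub inv by blast
    fix s assume "s \<in> N"
    then obtain s' where s': "s' \<in> N" "s = sep_image \<alpha> s'" using surj by blast
    show "prod.swap s \<in> sep_image \<alpha> ` \<sigma> \<longleftrightarrow> s \<notin> sep_image \<alpha> ` \<sigma>"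
      unfolding s'(2) swap_sep_image mem[OF s'(1)] mem[OF swap[OF s'(1)]]
      by (rule orientation_iff[OF \<sigma> s'(1)])
    fix t assume "t \<in> sep_image \<alpha> ` \<sigma>" and le: "sep_le s t"
    then obtain t' where t': "t' \<in> \<sigma>" "t = sep_image \<alpha> t'" by blast
    have "sep_le s' t'"
      using le sep_le_sep_image[OF inj, of s' t'] s' t' sub NV by blast
    then show "s \<in> sep_image \<alpha> ` \<sigma>"
      unfolding s'(2) mem[OF s'(1)] using orientation_down[OF \<sigma> t'(1) s'(1)] by blast
  qed
qed

text \<open>
  An automorphism acts on orientations elementwise. Since distinct nodes carry distinct
  orientations, transporting this action along the numbering of the nodes gives a
  homomorphism even when different nodes have equal parts.
\<close>
theorem induces_action_T:
  assumes NV: "N \<subseteq> Pow (pverts G) \<times> Pow (pverts G)"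
    and inv: "\<And>\<alpha> s. \<alpha> \<in> graph_auto G \<Longrightarrow> s \<in> N \<Longrightarrow> sep_image \<alpha> s \<in> N"
  shows "induces_action G T (\<lambda>i. part_of (pverts G) (L i))"
proof -
  interpret T: pair_graph T by (rule pair_graph_T)
  define \<phi> where "\<phi> \<alpha> = (\<lambda>i\<in>pverts T. inv_into (pverts T) L (sep_image \<alpha> ` L i))" for \<alpha>
  have auto_bij: "bij_betw \<alpha> (pverts G) (pverts G)" if "\<alpha> \<in> graph_auto G" for \<alpha>
    using that by (auto simp: graph_auto_def Bij_def)
  have auto_inj: "inj_on \<alpha> (pverts G)" if "\<alpha> \<in> graph_auto G" for \<alpha>
    using auto_bij[OF that] by (simp add: bij_betw_def)
  have injN: "inj_on (sep_image \<alpha>) N" if "\<alpha> \<in> graph_auto G" for \<alpha>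
    using inj_on_subset[OF sep_image_inj[OF auto_inj[OF that]] NV] .
  have LN: "L i \<subseteq> N" if "i \<in> pverts T" for i
    using orientation_subset[OF L_orientation[OF that]] .
  have im: "sep_image \<alpha> ` L i \<in> L ` pverts T" if "\<alpha> \<in> graph_auto G" "i \<in> pverts T" for \<alpha> i
  proof -
    have "sep_image \<alpha> ` L i \<in> orientations N"
      using inv[OF that(1)] by (intro sep_image_orientation[OF NV auto_inj[OF that(1)] _ L_orientation[OF that(2)]]) blast
    then show ?thesis using L_surj by blast
  qed
  have \<phi>T: "\<phi> \<alpha> i \<in> pverts T" if "\<alpha> \<in> graph_auto G" "i \<in> pverts T" for \<alpha> i
    using inv_into_into[OF im[OF that]] that(2) by (simp add: \<phi>_def)
  have L\<phi>: "L (\<phi> \<alpha> i) = sep_image \<alpha> ` L i" if "\<alpha> \<in> graph_auto G" "i \<in> pverts T" for \<alpha> i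
    using f_inv_into_f[OF im[OF that]] that(2) by (simp add: \<phi>_def)
  have \<phi>_auto: "\<phi> \<alpha> \<in> graph_auto T" if \<alpha>: "\<alpha> \<in> graph_auto G" for \<alpha>
  proof -
    have "inj_on (\<phi> \<alpha>) (pverts T)"
    proof (rule inj_onI)
      fix i j assume ij: "i \<in> pverts T" "j \<in> pverts T" "\<phi> \<alpha> i = \<phi> \<alpha> j"
      then have "sep_image \<alpha> ` L i = sep_image \<alpha> ` L j" using L\<phi>[OF \<alpha>] by metis
      then have "L i = L j" using inj_on_image_eq_iff[OF injN[OF \<alpha>] LN LN] ij by blast
      then show "i = j" using L_inj ij by blast
    qed
    moreover have "\<phi> \<alpha> ` pverts T \<subseteq> pverts T" using \<phi>T[OF \<alpha>] by blast
    ultimately have "\<phi> \<alpha> \<in> Bij (pverts T)"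
      using endo_inj_surj[OF T.pair_finite_verts]
      by (auto simp: Bij_def bij_betw_def \<phi>_def)
    moreover have "(\<phi> \<alpha> i, \<phi> \<alpha> j) \<in> parcs T \<longleftrightarrow> (i, j) \<in> parcs T"
      if ij: "i \<in> pverts T" "j \<in> pverts T" for i j
    proof -
      have "L (\<phi> \<alpha> i) - L (\<phi> \<alpha> j) = sep_image \<alpha> ` (L i - L j)"
        unfolding L\<phi>[OF \<alpha> ij(1)] L\<phi>[OF \<alpha> ij(2)]
        using LN[OF ij(1)] LN[OF ij(2)] by (intro inj_on_image_set_diff[OF injN[OF \<alpha>], symmetric]) auto
      moreover have "card (sep_image \<alpha> ` (L i - L j)) = card (L i - L j)"
        by (rule card_image, rule inj_on_subset[OF injN[OF \<alpha>]]) (use LN[OF ij(1)] in blast)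
      ultimately show ?thesis
        unfolding arc_iff using \<phi>T[OF \<alpha>] ij by (simp flip: card_1_singleton_iff One_nat_def)
    qed
    ultimately show ?thesis by (simp add: graph_auto_def)
  qed
  have "\<phi> \<in> hom (GraphAut G) (GraphAut T)"
  proof (rule homI)
    fix \<alpha> assume "\<alpha> \<in> carrier (GraphAut G)"
    then show "\<phi> \<alpha> \<in> carrier (GraphAut T)" using \<phi>_auto by simp
  next
    fix \<alpha> \<beta> assume "\<alpha> \<in> carrier (GraphAut G)" "\<beta> \<in> carrier (GraphAut G)"
    then have \<alpha>: "\<alpha> \<in> graph_auto G" and \<beta>: "\<beta> \<in> graph_auto G" by simp_all
    let ?\<gamma> = "compose (pverts G) \<alpha> \<beta>"
    have \<gamma>: "?\<gamma> \<in> graph_auto G" by (rule compose_graph_auto[OF \<alpha> \<beta>])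
    have "\<phi> ?\<gamma> = compose (pverts T) (\<phi> \<alpha>) (\<phi> \<beta>)"
    proof (rule extensionalityI[of _ "pverts T"])
      show "\<phi> ?\<gamma> \<in> extensional (pverts T)" by (simp add: \<phi>_def)
      show "compose (pverts T) (\<phi> \<alpha>) (\<phi> \<beta>) \<in> extensional (pverts T)" by simp
      fix i assume i: "i \<in> pverts T"
      have "sep_image ?\<gamma> s = sep_image \<alpha> (sep_image \<beta> s)" if "s \<in> L i" for s
        using sep_image_compose[of s "pverts G"] that LN[OF i] NV by blast
      then have "sep_image ?\<gamma> ` L i = sep_image \<alpha> ` sep_image \<beta> ` L i"
        by (simp add: image_image)
      then have "L (\<phi> ?\<gamma> i) = L (\<phi> \<alpha> (\<phi> \<beta> i))"
        using L\<phi>[OF \<gamma> i] L\<phi>[OF \<beta> i] L\<phi>[OF \<alpha> \<phi>T[OF \<beta> i]] by simp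
      then have "\<phi> ?\<gamma> i = \<phi> \<alpha> (\<phi> \<beta> i)"
        by (rule L_inj[OF \<phi>T[OF \<gamma> i] \<phi>T[OF \<alpha> \<phi>T[OF \<beta> i]]])
      then show "\<phi> ?\<gamma> i = compose (pverts T) (\<phi> \<alpha>) (\<phi> \<beta>) i" using i by (simp add: compose_eq)
    qed
    then show "\<phi> (\<alpha> \<otimes>\<^bsub>GraphAut G\<^esub> \<beta>) = \<phi> \<alpha> \<otimes>\<^bsub>GraphAut T\<^esub> \<phi> \<beta>"
      using mult_GraphAut[OF \<alpha> \<beta>] mult_GraphAut[OF \<phi>_auto[OF \<alpha>] \<phi>_auto[OF \<beta>]] by simp
  qed
  moreover have "part_of (pverts G) (L (\<phi> \<alpha> i)) = \<alpha> ` part_of (pverts G) (L i)"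
    if "\<alpha> \<in> graph_auto G" "i \<in> pverts T" for \<alpha> i
    unfolding L\<phi>[OF that] using part_of_sep_image[OF auto_bij[OF that(1)]] LN[OF that(2)] NV by blast
  ultimately show ?thesis
    unfolding induces_action_def by (intro bexI[of _ \<phi>]) simp_all
qed

end


section \<open>Corners of crossing separations\<close>

definition corner :: "'a set \<times> 'a set \<Rightarrow> 'a set \<times> 'a set \<Rightarrow> 'a set \<times> 'a set" where
  "corner s t = (fst s \<inter> fst t, snd s \<union> snd t)"

lemma corner_commute: "corner s t = corner t s"
  by (auto simp: corner_def)

lemma fst_corner [simp]: "fst (corner s t) = fst s \<inter> fst t"
  and snd_corner [simp]: "snd (corner s t) = snd s \<union> snd t"
  by (simp_all add: corner_def)

lemma sep_le_fst_snd: "sep_le s t \<longleftrightarrow> fst s \<subseteq> fst t \<and> snd t \<subseteq> snd s"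
  by (cases s; cases t) auto

lemma sep_order_fst_snd: "sep_order s = card (fst s \<inter> snd s)"
  by (cases s) auto

lemma sep_order_swap [simp]: "sep_order (prod.swap s) = sep_order s"
  by (cases s) (auto simp: Int_commute)

lemma corner_le: "sep_le (corner r s) r" "sep_le (corner r s) s"
  by (auto simp: sep_le_fst_snd)

lemma le_corner: "sep_le t r \<Longrightarrow> sep_le t s \<Longrightarrow> sep_le t (corner r s)"
  by (auto simp: sep_le_fst_snd)

lemma nested_corner_self: "nested (corner r s) r"
  using corner_le(1)[of r s] by (simp add: nested_iff)

lemma nested_corner_below:
  assumes "sep_le r t \<or> sep_le t (prod.swap r)"
  shows "nested t (corner r s)"
  using assms
proof
  assume "sep_le r t"
  then have "sep_le (corner r s) t" by (rule sep_le_trans[OF corner_le(1)])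
  then show ?thesis by (simp add: nested_iff)
next
  assume "sep_le t (prod.swap r)"
  then have "sep_le r (prod.swap t)" by (simp add: sep_le_swap_right)
  then have "sep_le (corner r s) (prod.swap t)" by (rule sep_le_trans[OF corner_le(1)])
  then show ?thesis by (simp add: nested_iff sep_le_swap_right)
qed

lemma nested_corner:
  assumes "crosses r s" "nested t r" "nested t s"
  shows "nested t (corner r s)"
proof -
  have r: "sep_le t r \<or> sep_le (prod.swap r) t \<or> nested t (corner r s)"
    using assms(2) nested_corner_below[of r t s] by (auto simp: nested_iff)
  have s: "sep_le t s \<or> sep_le (prod.swap s) t \<or> nested t (corner r s)"
    using assms(3) nested_corner_below[of s t r] by (auto simp: nested_iff corner_commute)
  have "nested t (corner r s)" if "sep_le t r" "sep_le t s"
    using le_corner[OF that] by (simp add: nested_iff)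
  moreover have False if "sep_le t r" "sep_le (prod.swap s) t"
    using sep_le_trans[OF that(2,1)] assms(1) by (simp add: nested_iff sep_le_swap_left)
  moreover have False if "sep_le t s" "sep_le (prod.swap r) t"
    using sep_le_trans[OF that(2,1)] assms(1) by (simp add: nested_iff sep_le_swap_left)
  moreover have "nested t (corner r s)" if "sep_le (prod.swap r) t" "sep_le (prod.swap s) t"
  proof -
    have "sep_le (prod.swap t) r" "sep_le (prod.swap t) s" using that by (simp_all add: sep_le_swap_left)
    from le_corner[OF this] show ?thesis by (simp add: nested_iff sep_le_swap_left)
  qed
  ultimately show ?thesis using r s by blast
qed

lemma nested_opposite_corners:
  assumes "nested t r"
  shows "nested t (corner r s) \<or> nested t (corner (prod.swap r) (prod.swap s))"
  using assms nested_corner_below[of r t s] nested_corner_below[of "prod.swap r" t "prod.swap s"]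
  by (auto simp: nested_iff)

definition crossing_number :: "('a set \<times> 'a set) set \<Rightarrow> 'a set \<times> 'a set \<Rightarrow> nat" where
  "crossing_number S s = card {t \<in> S. crosses t s}"

lemma crossing_number_swap [simp]: "crossing_number S (prod.swap s) = crossing_number S s"
  by (simp add: crossing_number_def)

text \<open>
  A separation crossing a corner crosses \<open>r\<close> or \<open>s\<close>, and one crossing both corners crosses
  both \<open>r\<close> and \<open>s\<close>. The inequality is strict because \<open>r\<close> crosses \<open>s\<close> but neither corner.
\<close>
lemma crossing_number_corners:
  assumes fin: "finite S" and r: "r \<in> S" and s: "s \<in> S" and rs: "crosses r s"
  shows "crossing_number S (corner r s) + crossing_number S (corner (prod.swap r) (prod.swap s))
    < crossing_number S r + crossing_number S s"
proof -
  define X where "X u = {t \<in> S. crosses t u}" for u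
  let ?c = "corner r s" and ?c' = "corner (prod.swap r) (prod.swap s)"
  have finX: "finite (X u)" for u using fin by (simp add: X_def)
  have un: "X ?c \<union> X ?c' \<subseteq> X r \<union> X s"
    using nested_corner[OF rs] nested_corner[of "prod.swap r" "prod.swap s"] rs
    by (auto simp: X_def simp del: split_paired_All)
  have int: "X ?c \<inter> X ?c' \<subseteq> X r \<inter> X s"
    using nested_opposite_corners[of _ r s] nested_opposite_corners[of _ s r]
    by (auto simp: X_def corner_commute simp del: split_paired_All)
  have "r \<in> X r \<union> X s" using r rs by (simp add: X_def)
  moreover have "nested r ?c" using nested_corner_self nested_sym by blast
  then have "r \<notin> X ?c" by (simp add: X_def)
  moreover have "nested r ?c'"
    using nested_corner_self[of "prod.swap r" "prod.swap s"] nested_sym nested_swap_right by blast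
  then have "r \<notin> X ?c'" by (simp add: X_def)
  ultimately have "X ?c \<union> X ?c' \<subset> X r \<union> X s" using un by blast
  then have "card (X ?c \<union> X ?c') < card (X r \<union> X s)"
    by (rule psubset_card_mono[rotated]) (simp add: finX)
  moreover have "card (X ?c \<inter> X ?c') \<le> card (X r \<inter> X s)"
    using int finX by (intro card_mono) auto
  ultimately have "card (X ?c) + card (X ?c') < card (X r) + card (X s)"
    using card_Un_Int[OF finX finX, of ?c ?c'] card_Un_Int[OF finX finX, of r s] by linarith
  then show ?thesis by (simp add: crossing_number_def X_def)
qed

text \<open>
  Submodularity of the order, with equality for opposite corners.
\<close>
lemma sep_order_corners:
  assumes "finite V" "fst s \<union> snd s = V" "fst t \<union> snd t = V"
  shows "sep_order (corner s t) + sep_order (corner (prod.swap s) (prod.swap t))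
    = sep_order s + sep_order t"
proof -
  let ?X = "fst s \<inter> fst t \<inter> (snd s \<union> snd t)" and ?Y = "snd s \<inter> snd t \<inter> (fst s \<union> fst t)"
  have fin: "finite (fst s)" "finite (snd s)" "finite (fst t)" "finite (snd t)"
    using assms by (auto intro: finite_subset)
  have "?X \<union> ?Y = (fst s \<inter> snd s) \<union> (fst t \<inter> snd t)" using assms(2,3) by blast
  moreover have "?X \<inter> ?Y = (fst s \<inter> snd s) \<inter> (fst t \<inter> snd t)" by blast
  moreover have "card ?X + card ?Y = card (?X \<union> ?Y) + card (?X \<inter> ?Y)"
    using fin by (intro card_Un_Int) auto
  moreover have "card (fst s \<inter> snd s) + card (fst t \<inter> snd t)
      = card ((fst s \<inter> snd s) \<union> (fst t \<inter> snd t)) + card ((fst s \<inter> snd s) \<inter> (fst t \<inter> snd t))"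
    using fin by (intro card_Un_Int) auto
  ultimately show ?thesis by (simp add: sep_order_fst_snd)
qed

section \<open>Selecting nested distinguishers\<close>

definition distinguishes :: "'a set \<times> 'a set \<Rightarrow> 'a set \<times> 'a set \<Rightarrow> bool" where
  "distinguishes s p \<longleftrightarrow> fst p \<subseteq> fst s \<and> snd p \<subseteq> snd s"

definition level :: "('a set \<times> 'a set) set \<Rightarrow> 'a set \<times> 'a set \<Rightarrow> nat" where
  "level S p = (LEAST l. \<exists>s\<in>S. distinguishes s p \<and> sep_order s = l)"

text \<open>
  For \<open>M = {}\<close> these are all efficient distinguishers of \<open>p\<close>; in the selection \<open>M\<close>
  consists of the separations chosen at lower levels.
\<close>
definition candidates ::
    "('a set \<times> 'a set) set \<Rightarrow> ('a set \<times> 'a set) set \<Rightarrow> 'a set \<times> 'a set \<Rightarrow> ('a set \<times> 'a set) set" where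
  "candidates S M p =
     {s \<in> S. distinguishes s p \<and> sep_order s = level S p \<and> (\<forall>t\<in>M. nested s t)}"

definition least_crossing :: "('a set \<times> 'a set) set \<Rightarrow> ('a set \<times> 'a set) set \<Rightarrow> 'a set \<times> 'a set \<Rightarrow> ('a set \<times> 'a set) set" where
  "least_crossing S M p = {s \<in> candidates S M p. \<forall>t\<in>candidates S M p. crossing_number S s \<le> crossing_number S t}"

text \<open>
  All minimisers are kept. Choosing one of them would destroy invariance under
  automorphisms.
\<close>
primrec selection :: "('a set \<times> 'a set) set \<Rightarrow> ('a set \<times> 'a set) set \<Rightarrow> nat \<Rightarrow> ('a set \<times> 'a set) set" where
  "selection S I 0 = {}"
| "selection S I (Suc l) = selection S I l \<union> (\<Union>p\<in>{p \<in> I. level S p = l}. least_crossing S (selection S I l) p)"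

lemma distinguishes_swap [simp]: "distinguishes (prod.swap s) (prod.swap p) \<longleftrightarrow> distinguishes s p"
  by (auto simp: distinguishes_def)

lemma selection_mono: "k \<le> l \<Longrightarrow> selection S I k \<subseteq> selection S I l"
  by (induction rule: dec_induct) auto

text \<open>
  The properties of pairs of robust blocks that the selection relies on, for an arbitrary
  corner-closed family \<open>S\<close> of bipartitions with overlap. In the robustness axiom \<open>s\<close> is an
  efficient distinguisher for \<open>p\<close> up to its second side, and \<open>t\<close> has the order of one for
  another pair \<open>q\<close>.
\<close>
locale distinguishable_pairs =
  fixes V :: "'a set" and S I :: "('a set \<times> 'a set) set"
  assumes finite_V: "finite V"
    and sides: "s \<in> S \<Longrightarrow> fst s \<union> snd s = V"
    and swap_S: "s \<in> S \<Longrightarrow> prod.swap s \<in> S"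
    and corner_S: "s \<in> S \<Longrightarrow> t \<in> S \<Longrightarrow> corner s t \<in> S"
    and swap_I: "p \<in> I \<Longrightarrow> prod.swap p \<in> I"
    and ex_distinguisher: "p \<in> I \<Longrightarrow> \<exists>s\<in>S. distinguishes s p"
    and one_side: "p \<in> I \<Longrightarrow> s \<in> S \<Longrightarrow> sep_order s \<le> level S p \<Longrightarrow> fst p \<subseteq> fst s \<or> fst p \<subseteq> snd s"
    and large: "p \<in> I \<Longrightarrow> level S p < card (fst p)"
    and robust: "p \<in> I \<Longrightarrow> q \<in> I \<Longrightarrow> s \<in> S \<Longrightarrow> t \<in> S \<Longrightarrow> fst p \<subseteq> fst s \<Longrightarrow>
       sep_order s = level S p \<Longrightarrow> sep_order t = level S q \<Longrightarrow> crosses s t \<Longrightarrow>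
       sep_order (corner s t) < level S p \<Longrightarrow> sep_order (corner s (prod.swap t)) < level S p \<Longrightarrow>
       fst p \<subseteq> fst t \<or> fst p \<subseteq> snd t"
begin

lemma finite_S: "finite S"
proof (rule finite_subset)
  show "S \<subseteq> Pow V \<times> Pow V" using sides by (force simp: mem_Times_iff)
qed (simp add: finite_V)

lemma level_le: "s \<in> S \<Longrightarrow> distinguishes s p \<Longrightarrow> level S p \<le> sep_order s"
  unfolding level_def by (rule Least_le) blast

lemma level_attained: "p \<in> I \<Longrightarrow> \<exists>s\<in>S. distinguishes s p \<and> sep_order s = level S p"
  unfolding level_def by (rule LeastI_ex) (use ex_distinguisher in blast)

lemma level_swap [simp]: "level S (prod.swap p) = level S p"
proof -
  have "(\<exists>s\<in>S. distinguishes s (prod.swap p) \<and> sep_order s = l) \<longleftrightarrow>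
      (\<exists>s\<in>S. distinguishes s p \<and> sep_order s = l)" for l
    using swap_S by (metis distinguishes_swap sep_order_swap swap_swap)
  then show ?thesis by (simp add: level_def)
qed

lemma one_side': "p \<in> I \<Longrightarrow> s \<in> S \<Longrightarrow> sep_order s \<le> level S p \<Longrightarrow> snd p \<subseteq> fst s \<or> snd p \<subseteq> snd s"
  using one_side[OF swap_I, of p s] by simp

lemma candidates_swap:
  assumes "s \<in> candidates S M p"
  shows "prod.swap s \<in> candidates S M (prod.swap p)"
  using assms swap_S by (simp add: candidates_def)

lemma least_crossing_swap:
  assumes "s \<in> least_crossing S M p"
  shows "prod.swap s \<in> least_crossing S M (prod.swap p)"
proof -
  have "crossing_number S s \<le> crossing_number S t" if "t \<in> candidates S M (prod.swap p)" for t
    using candidates_swap[OF that] assms by (auto simp: least_crossing_def dest!: bspec)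
  then show ?thesis using candidates_swap assms by (auto simp: least_crossing_def)
qed

lemma not_small:
  assumes "p \<in> I" "s \<in> candidates S M p"
  shows "\<not> sep_le s (prod.swap s)"
proof
  assume "sep_le s (prod.swap s)"
  then have "fst p \<subseteq> fst s \<inter> snd s"
    using assms(2) by (auto simp: candidates_def distinguishes_def sep_le_fst_snd)
  moreover have "finite (fst s \<inter> snd s)"
    using assms(2) sides[of s] finite_V by (auto simp: candidates_def intro: finite_subset)
  ultimately have "card (fst p) \<le> sep_order s" by (simp add: sep_order_fst_snd card_mono)
  then show False using large[OF assms(1)] assms(2) by (simp add: candidates_def)
qed

text \<open>
  The pair \<open>p\<close> lies behind \<open>r\<close>, so both corners of \<open>s\<close> behind \<open>r\<close> distinguish \<open>p\<close> and have
  order at least \<open>level S p\<close>. If neither attains it, submodularity pushes the two corners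
  in front of \<open>r\<close> below the order of \<open>r\<close>. Robustness puts \<open>fst q\<close> into one of them, which
  then distinguishes \<open>q\<close> too cheaply.
\<close>
lemma uncross_lower_aux:
  assumes q: "q \<in> I" and r: "r \<in> S" "distinguishes r q" "sep_order r = level S q"
    and p: "p \<in> I" and s: "s \<in> S" "distinguishes s p" "sep_order s = level S p"
    and cross: "crosses r s" and behind: "fst p \<subseteq> snd r" "snd p \<subseteq> snd r"
  shows "\<exists>s'\<in>S. distinguishes s' p \<and> sep_order s' = level S p \<and> nested r s' \<and>
    (\<forall>t. nested t r \<longrightarrow> nested t s \<longrightarrow> nested t s')"
proof -
  let ?a = "corner (prod.swap r) s" and ?b = "corner (prod.swap r) (prod.swap s)"
  have S: "?a \<in> S" "?b \<in> S" "corner r s \<in> S" "corner r (prod.swap s) \<in> S"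
    using r s swap_S corner_S by simp_all
  have dist: "distinguishes ?a p" "distinguishes (prod.swap ?b) p"
    using s(2) behind by (auto simp: distinguishes_def)
  have ge: "level S p \<le> sep_order ?a" "level S p \<le> sep_order ?b"
    using level_le[OF S(1) dist(1)] level_le[OF swap_S[OF S(2)] dist(2)] by simp_all
  have sub1: "sep_order ?a + sep_order (corner r (prod.swap s)) = level S q + level S p"
    using sep_order_corners[OF finite_V sides[OF swap_S[OF r(1)]] sides[OF s(1)]] r(3) s(3) by simp
  have sub2: "sep_order ?b + sep_order (corner r s) = level S q + level S p"
    using sep_order_corners[OF finite_V sides[OF r(1)] sides[OF s(1)]] r(3) s(3) by simp
  consider "sep_order ?a = level S p" | "sep_order ?b = level S p"
    | "sep_order (corner r (prod.swap s)) < level S q" "sep_order (corner r s) < level S q"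
    using ge sub1 sub2 by linarith
  then show ?thesis
  proof cases
    case 1
    have "nested r ?a" using nested_corner_self[of "prod.swap r" s] by (simp add: nested_sym)
    moreover have "nested t ?a" if "nested t r" "nested t s" for t
      using nested_corner[of "prod.swap r" s t] cross that by simp
    ultimately show ?thesis using S(1) dist(1) 1 by blast
  next
    case 2
    have "nested r (prod.swap ?b)"
      using nested_corner_self[of "prod.swap r" "prod.swap s"] by (simp add: nested_sym)
    moreover have "nested t (prod.swap ?b)" if "nested t r" "nested t s" for t
      using nested_corner[of "prod.swap r" "prod.swap s" t] cross that by simp
    ultimately show ?thesis using swap_S[OF S(2)] dist(2) 2 sep_order_swap by metis
  next
    case 3
    have "fst q \<subseteq> fst r" "snd q \<subseteq> snd r" using r(2) by (simp_all add: distinguishes_def)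
    moreover have "fst q \<subseteq> fst s \<or> fst q \<subseteq> snd s"
      using robust[OF q p r(1) s(1) _ r(3) s(3) cross] 3 calculation by blast
    ultimately have "distinguishes (corner r s) q \<or> distinguishes (corner r (prod.swap s)) q"
      by (auto simp: distinguishes_def)
    then show ?thesis using level_le S(3,4) 3 by (meson not_less)
  qed
qed

lemma uncross_lower:
  assumes q: "q \<in> I" and r: "r \<in> S" "distinguishes r q" "sep_order r = level S q"
    and p: "p \<in> I" and s: "s \<in> S" "distinguishes s p" "sep_order s = level S p"
    and cross: "crosses r s" and less: "level S q < level S p"
  shows "\<exists>s'\<in>S. distinguishes s' p \<and> sep_order s' = level S p \<and> nested r s' \<and>
    (\<forall>t. nested t r \<longrightarrow> nested t s \<longrightarrow> nested t s')"
proof -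
  have nd: "\<not> distinguishes r p" "\<not> distinguishes (prod.swap r) p"
    using level_le[OF r(1)] level_le[OF swap_S[OF r(1)]] r(3) less by fastforce+
  have "fst p \<subseteq> fst r \<or> fst p \<subseteq> snd r" "snd p \<subseteq> fst r \<or> snd p \<subseteq> snd r"
    using one_side[OF p r(1)] one_side'[OF p r(1)] r(3) less by simp_all
  then consider "fst p \<subseteq> snd r" "snd p \<subseteq> snd r" | "fst p \<subseteq> fst r" "snd p \<subseteq> fst r"
    using nd by (auto simp: distinguishes_def)
  then show ?thesis
  proof cases
    case 1 show ?thesis by (rule uncross_lower_aux[OF q r p s cross 1])
  next
    case 2
    have "\<exists>s'\<in>S. distinguishes s' p \<and> sep_order s' = level S p \<and> nested (prod.swap r) s' \<and>
        (\<forall>t. nested t (prod.swap r) \<longrightarrow> nested t s \<longrightarrow> nested t s')"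
      by (rule uncross_lower_aux[OF swap_I[OF q] swap_S[OF r(1)] _ _ p s]) (use r cross 2 in simp_all)
    then show ?thesis by simp
  qed
qed

text \<open>
  A distinguisher that crosses as few members of \<open>M\<close> as possible crosses none: uncrossing
  it with one of them removes that crossing and, as \<open>M\<close> is nested, creates no new one.
\<close>
lemma candidates_nonempty:
  assumes p: "p \<in> I" and finM: "finite M"
    and M: "\<And>r. r \<in> M \<Longrightarrow> \<exists>q\<in>I. r \<in> candidates S {} q \<and> level S q < level S p"
    and nestedM: "\<And>r t. r \<in> M \<Longrightarrow> t \<in> M \<Longrightarrow> nested r t"
  shows "candidates S M p \<noteq> {}"
proof -
  define D where "D = candidates S {} p"
  define c where "c s = card {t \<in> M. crosses t s}" for s
  have "\<exists>s. s \<in> D" using level_attained[OF p] by (auto simp: D_def candidates_def)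
  from ex_has_least_nat[of "\<lambda>s. s \<in> D" _ c] this
  obtain s where s: "s \<in> D" and min: "\<And>t. t \<in> D \<Longrightarrow> c s \<le> c t" by blast
  have "nested r s" if r: "r \<in> M" for r
  proof (rule ccontr)
    assume cross: "crosses r s"
    obtain q where q: "q \<in> I" "r \<in> candidates S {} q" "level S q < level S p" using M[OF r] by blast
    obtain s' where s': "s' \<in> S" "distinguishes s' p" "sep_order s' = level S p" "nested r s'"
      and uncrossed: "\<And>t. nested t r \<Longrightarrow> nested t s \<Longrightarrow> nested t s'"
      using uncross_lower[OF q(1) _ _ _ p _ _ _ cross q(3)] q(2) s
      unfolding D_def candidates_def by blast
    have "{t \<in> M. crosses t s'} \<subset> {t \<in> M. crosses t s}"
      using uncrossed nestedM[OF _ r] s'(4) cross r by blast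
    then have "c s' < c s" unfolding c_def using finM by (intro psubset_card_mono) auto
    moreover have "s' \<in> D" using s' by (simp add: D_def candidates_def)
    ultimately show False using min[of s'] by simp
  qed
  then have "\<forall>r\<in>M. nested s r" using nested_sym by blast
  then have "s \<in> candidates S M p" using s by (simp add: D_def candidates_def)
  then show ?thesis by blast
qed

lemma corner_candidate:
  assumes r: "r \<in> candidates S M p" and s: "s \<in> S" "sep_order s = level S p" "\<forall>t\<in>M. nested s t"
    and cross: "crosses r s" and X: "fst p \<subseteq> fst s"
  shows "level S p \<le> sep_order (corner r s)"
    and "sep_order (corner r s) = level S p \<Longrightarrow> corner r s \<in> candidates S M p"
proof -
  have S: "corner r s \<in> S" using r s corner_S by (simp add: candidates_def)
  have dist: "distinguishes (corner r s) p" using r X by (auto simp: candidates_def distinguishes_def)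
  show "level S p \<le> sep_order (corner r s)" by (rule level_le[OF S dist])
  have "nested (corner r s) t" if "t \<in> M" for t
  proof -
    have "nested t r" "nested t s"
      using r s(3) that by (simp_all add: candidates_def nested_sym[of t])
    then show ?thesis using nested_corner[OF cross] nested_sym by blast
  qed
  then show "corner r s \<in> candidates S M p" if "sep_order (corner r s) = level S p"
    using that S dist by (simp add: candidates_def)
qed

lemma corner_least_crossing:
  assumes r: "r \<in> least_crossing S M p" and s: "s \<in> candidates S M q" and lev: "level S p = level S q"
    and cross: "crosses r s" and X: "fst p \<subseteq> fst s"
  shows "level S q \<le> sep_order (corner r s) \<and> (sep_order (corner r s) = level S q \<longrightarrow>
      crossing_number S r \<le> crossing_number S (corner r s))"
proof -
  have rc: "r \<in> candidates S M p" using r by (simp add: least_crossing_def)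
  have s': "s \<in> S" "sep_order s = level S p" "\<forall>t\<in>M. nested s t"
    using s lev by (simp_all add: candidates_def)
  note c = corner_candidate[OF rc s' cross X]
  show ?thesis using c r unfolding least_crossing_def lev by blast
qed

text \<open>
  Suppose that \<open>r\<close> and \<open>s\<close> cross. Each of the four sets of the two pairs lies in one
  corner, which therefore has order at least the common level \<open>l\<close>. Opposite corners have
  total order \<open>2l\<close>, so if two opposite corners are both occupied they have order \<open>l\<close> and
  are candidates themselves, and their crossing numbers are bounded below by those of \<open>r\<close>
  or \<open>s\<close>. Some opposite corners are occupied. If one can be charged to \<open>r\<close> and the other
  to \<open>s\<close>, this contradicts \<open>crossing_number_corners\<close>. Otherwise one opposite pair is
  charged twice to \<open>r\<close> and the other one twice to \<open>s\<close>, which makes each of the two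
  crossing numbers smaller than the other.
\<close>
lemma least_crossing_nested:
  assumes p: "p \<in> I" and q: "q \<in> I" and lev: "level S p = level S q"
    and r: "r \<in> least_crossing S M p" and s: "s \<in> least_crossing S M q"
  shows "nested r s"
proof (rule ccontr)
  assume cross: "crosses r s"
  then have cross': "crosses s r" by (simp add: nested_sym)
  let ?r = "prod.swap r" and ?s = "prod.swap s"
  let ?l = "level S q"
  have rc: "r \<in> candidates S M p" and sc: "s \<in> candidates S M q" using r s by (simp_all add: least_crossing_def)
  have rS: "r \<in> S" "sep_order r = ?l" and sS: "s \<in> S" "sep_order s = ?l"
    using rc sc lev by (simp_all add: candidates_def)
  note rc' = candidates_swap[OF rc] and sc' = candidates_swap[OF sc]
  note r' = least_crossing_swap[OF r] and s' = least_crossing_swap[OF s]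
  let ?o = "\<lambda>c R. ?l \<le> sep_order c \<and> (sep_order c = ?l \<longrightarrow> crossing_number S R \<le> crossing_number S c)"
  have "fst p \<subseteq> fst s \<or> fst p \<subseteq> snd s" using one_side[OF p sS(1)] sS(2) lev by simp
  then have X: "?o (corner r s) r \<or> ?o (corner r ?s) r"
    using corner_least_crossing[OF r sc lev cross] corner_least_crossing[OF r sc'] cross lev by auto
  have "snd p \<subseteq> fst s \<or> snd p \<subseteq> snd s" using one_side'[OF p sS(1)] sS(2) lev by simp
  then have Y: "?o (corner ?r s) r \<or> ?o (corner ?r ?s) r"
    using corner_least_crossing[OF r' sc] corner_least_crossing[OF r' sc'] cross lev by auto
  have "fst q \<subseteq> fst r \<or> fst q \<subseteq> snd r" using one_side[OF q rS(1)] rS(2) by simp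
  then have Z: "?o (corner r s) s \<or> ?o (corner ?r s) s"
    using corner_least_crossing[OF s rc lev[symmetric] cross'] corner_least_crossing[OF s rc'] cross' lev
    by (auto simp: corner_commute[of s])
  have "snd q \<subseteq> fst r \<or> snd q \<subseteq> snd r" using one_side'[OF q rS(1)] rS(2) by simp
  then have W: "?o (corner r ?s) s \<or> ?o (corner ?r ?s) s"
    using corner_least_crossing[OF s' rc] corner_least_crossing[OF s' rc'] cross' lev
    by (auto simp: corner_commute[of ?s])
  have o1: "sep_order (corner r s) + sep_order (corner ?r ?s) = ?l + ?l"
    using sep_order_corners[OF finite_V sides[OF rS(1)] sides[OF sS(1)]] rS(2) sS(2) by simp
  have o2: "sep_order (corner r ?s) + sep_order (corner ?r s) = ?l + ?l"
    using sep_order_corners[OF finite_V sides[OF rS(1)] sides[OF swap_S[OF sS(1)]]] rS(2) sS(2) by simp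
  have c1: "crossing_number S (corner r s) + crossing_number S (corner ?r ?s)
      < crossing_number S r + crossing_number S s"
    by (rule crossing_number_corners[OF finite_S rS(1) sS(1) cross])
  have c2: "crossing_number S (corner r ?s) + crossing_number S (corner ?r s)
      < crossing_number S r + crossing_number S s"
    using crossing_number_corners[OF finite_S rS(1) swap_S[OF sS(1)]] cross by simp
  \<comment> \<open>16 cases, according to the corners that contain the four sets.\<close>
  show False using X Y Z W o1 o2 c1 c2 by (elim disjE conjE) linarith+
qed

lemma selection_props:
  "(\<forall>s\<in>selection S I l. \<exists>p\<in>I. s \<in> candidates S {} p \<and> level S p < l) \<and>
   (\<forall>r\<in>selection S I l. \<forall>s\<in>selection S I l. nested r s) \<and>
   (\<forall>p\<in>I. level S p < l \<longrightarrow> (\<exists>s\<in>selection S I l. s \<in> candidates S {} p)) \<and>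
   (\<forall>s\<in>selection S I l. prod.swap s \<in> selection S I l)"
proof (induction l)
  case 0
  show ?case by simp
next
  case (Suc l)
  let ?M = "selection S I l"
  let ?B = "\<lambda>p. least_crossing S ?M p"
  have old: "\<forall>s\<in>?M. \<exists>p\<in>I. s \<in> candidates S {} p \<and> level S p < l"
    and nestedM: "\<forall>r\<in>?M. \<forall>s\<in>?M. nested r s"
    and met: "\<forall>p\<in>I. level S p < l \<longrightarrow> (\<exists>s\<in>?M. s \<in> candidates S {} p)"
    and swapM: "\<forall>s\<in>?M. prod.swap s \<in> ?M"
    using Suc.IH by blast+
  have Suc_iff: "s \<in> selection S I (Suc l) \<longleftrightarrow> s \<in> ?M \<or> (\<exists>p\<in>I. level S p = l \<and> s \<in> ?B p)" for s
    by auto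
  have weak: "s \<in> candidates S {} p" if "s \<in> ?B p" for s p
    using that by (simp add: least_crossing_def candidates_def)
  have new: "nested r s" if "r \<in> ?M" "s \<in> ?B p" for r s p
    using that by (simp add: least_crossing_def candidates_def nested_sym[of r s])
  show ?case
  proof (intro conjI ballI impI)
    fix s assume "s \<in> selection S I (Suc l)"
    then show "\<exists>p\<in>I. s \<in> candidates S {} p \<and> level S p < Suc l"
      unfolding Suc_iff using old weak less_Suc_eq by blast
  next
    fix r s assume r: "r \<in> selection S I (Suc l)" and s: "s \<in> selection S I (Suc l)"
    consider "r \<in> ?M" "s \<in> ?M" | p where "r \<in> ?M" "s \<in> ?B p" | p where "s \<in> ?M" "r \<in> ?B p"
      | p q where "p \<in> I" "q \<in> I" "level S p = l" "level S q = l" "r \<in> ?B p" "s \<in> ?B q"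
      using r s unfolding Suc_iff by blast
    then show "nested r s"
    proof cases
      case 1 then show ?thesis using nestedM by blast
    next
      case 2 then show ?thesis by (rule new)
    next
      case 3 then show ?thesis using new[OF 3] by (simp add: nested_sym)
    next
      case 4 then show ?thesis using least_crossing_nested[OF 4(1,2) _ 4(5,6)] by simp
    qed
  next
    fix p assume p: "p \<in> I" "level S p < Suc l"
    show "\<exists>s\<in>selection S I (Suc l). s \<in> candidates S {} p"
    proof (cases "level S p < l")
      case True
      then show ?thesis unfolding Bex_def Suc_iff using met p(1) by blast
    next
      case False
      then have l: "level S p = l" using p(2) by simp
      have "?M \<subseteq> S" using old by (auto simp: candidates_def)
      then have "finite ?M" using finite_S finite_subset by blast
      then have "candidates S ?M p \<noteq> {}"
        by (rule candidates_nonempty[OF p(1)]) (use old nestedM l in blast)+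
      then obtain s0 where "s0 \<in> candidates S ?M p" by blast
      from ex_has_least_nat[of "\<lambda>s. s \<in> candidates S ?M p", OF this, of "crossing_number S"]
      obtain s where "s \<in> ?B p" unfolding least_crossing_def by blast
      then show ?thesis unfolding Bex_def Suc_iff using l p(1) weak by blast
    qed
  next
    fix s assume "s \<in> selection S I (Suc l)"
    then show "prod.swap s \<in> selection S I (Suc l)"
      unfolding Suc_iff using swapM least_crossing_swap swap_I level_swap by metis
  qed
qed

end


lemma sep_order_sep_image:
  assumes "inj_on \<alpha> V" "s \<in> Pow V \<times> Pow V"
  shows "sep_order (sep_image \<alpha> s) = sep_order s"
proof -
  have s: "fst s \<subseteq> V" "snd s \<subseteq> V" using assms(2) by (auto simp: mem_Times_iff)
  have "inj_on \<alpha> (fst s \<inter> snd s)" using s by (intro inj_on_subset[OF assms(1)]) auto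
  then show ?thesis
    by (simp add: sep_order_fst_snd sep_image_def card_image flip: inj_on_image_Int[OF assms(1) s])
qed

lemma distinguishes_sep_image:
  assumes "inj_on \<alpha> V" "s \<in> Pow V \<times> Pow V" "p \<in> Pow V \<times> Pow V"
  shows "distinguishes (sep_image \<alpha> s) (sep_image \<alpha> p) \<longleftrightarrow> distinguishes s p"
  using assms(2,3) inj_on_image_subset_cancel[OF assms(1)]
  by (auto simp: distinguishes_def sep_image_def mem_Times_iff)

lemma corner_sep_image:
  assumes "inj_on \<alpha> V" "s \<in> Pow V \<times> Pow V" "t \<in> Pow V \<times> Pow V"
  shows "corner (sep_image \<alpha> s) (sep_image \<alpha> t) = sep_image \<alpha> (corner s t)"
  using assms(2,3) inj_on_image_Int[OF assms(1), of "fst s" "fst t"]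
  by (auto simp: corner_def sep_image_def mem_Times_iff image_Un)

text \<open>
  Every notion entering the selection commutes with \<open>\<alpha>\<close>. Finiteness upgrades
  invariance of \<open>S\<close> from inclusion to equality, which stands in for the inverse of
  \<open>\<alpha>\<close>.
\<close>
lemma (in distinguishable_pairs) selection_sep_image:
  assumes IV: "I \<subseteq> Pow V \<times> Pow V" and \<alpha>: "bij_betw \<alpha> V V"
    and S: "sep_image \<alpha> ` S \<subseteq> S" and I: "sep_image \<alpha> ` I \<subseteq> I"
  shows "sep_image \<alpha> ` selection S I l \<subseteq> selection S I l"
proof -
  let ?g = "sep_image \<alpha>"
  have inj: "inj_on \<alpha> V" using \<alpha> by (simp add: bij_betw_def)
  have SV: "S \<subseteq> Pow V \<times> Pow V" using sides by (force simp: mem_Times_iff)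
  have sel: "selection S I l \<subseteq> S" for l
    using selection_props[of l] by (auto simp: candidates_def)
  have injg: "inj_on ?g M" if "M \<subseteq> S" for M
    using inj_on_subset[OF sep_image_inj[OF inj]] that SV by blast
  have onto: "?g ` M = M" if "?g ` M \<subseteq> M" "M \<subseteq> S" for M
    using endo_inj_surj[OF finite_subset[OF that(2) finite_S] that(1) injg[OF that(2)]] .
  note gS = onto[OF S subset_refl]
  have exS: "(\<exists>s\<in>S. P s) \<longleftrightarrow> (\<exists>s\<in>S. P (?g s))" for P
    using gS by (metis (no_types) imageE imageI)
  have level: "level S (?g p) = level S p" if "p \<in> Pow V \<times> Pow V" for p
  proof -
    have "(\<exists>s\<in>S. distinguishes s (?g p) \<and> sep_order s = l) \<longleftrightarrow>
        (\<exists>s\<in>S. distinguishes s p \<and> sep_order s = l)" for l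
      unfolding exS[of "\<lambda>s. distinguishes s (?g p) \<and> sep_order s = l"]
      using distinguishes_sep_image[OF inj _ that] sep_order_sep_image[OF inj] SV
      by (intro bex_cong refl) (metis subsetD)
    then show ?thesis by (simp add: level_def)
  qed
  have cross: "crossing_number S (?g s) = crossing_number S s" if "s \<in> S" for s
  proof -
    have "{t \<in> S. crosses t (?g s)} = ?g ` {t \<in> S. crosses t s}"
    proof (intro equalityI subsetI)
      fix t assume t: "t \<in> {t \<in> S. crosses t (?g s)}"
      then obtain t' where t': "t' \<in> S" "t = ?g t'" using gS by blast
      then show "t \<in> ?g ` {t \<in> S. crosses t s}"
        using t nested_sep_image[OF inj, of t' s] SV that by blast
    next
      fix t assume "t \<in> ?g ` {t \<in> S. crosses t s}"
      then obtain t' where t': "t' \<in> S" "crosses t' s" "t = ?g t'" by blast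
      moreover have "?g t' \<in> S" using S t'(1) by blast
      ultimately show "t \<in> {t \<in> S. crosses t (?g s)}"
        using nested_sep_image[OF inj, of t' s] SV that by blast
    qed
    moreover have "card (?g ` {t \<in> S. crosses t s}) = card {t \<in> S. crosses t s}"
      by (intro card_image injg) blast
    ultimately show ?thesis by (simp add: crossing_number_def)
  qed
  have cand: "?g s \<in> candidates S M (?g p) \<longleftrightarrow> s \<in> candidates S M p"
    if M: "?g ` M = M" "M \<subseteq> S" and p: "p \<in> Pow V \<times> Pow V" and s: "s \<in> S" for M p s
  proof -
    have sV: "s \<in> Pow V \<times> Pow V" using s SV by blast
    have gs: "?g s \<in> S" using s S by blast
    have "(\<forall>t\<in>M. nested (?g s) t) \<longleftrightarrow> (\<forall>t\<in>M. nested (?g s) (?g t))"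
      using M(1) by (metis (no_types) imageE imageI)
    also have "\<dots> \<longleftrightarrow> (\<forall>t\<in>M. nested s t)"
      using nested_sep_image[OF inj sV] M(2) SV by (intro ball_cong refl) blast
    finally show ?thesis
      using gs s level[OF p] distinguishes_sep_image[OF inj sV p] sep_order_sep_image[OF inj sV]
      by (simp add: candidates_def)
  qed
  show ?thesis
  proof (induction l)
    case 0
    show ?case by simp
  next
    case (Suc l)
    let ?M = "selection S I l"
    have M: "?g ` ?M = ?M" by (rule onto[OF Suc.IH sel])
    have least_crossing: "?g s \<in> least_crossing S ?M (?g p)" if p: "p \<in> I" and s: "s \<in> least_crossing S ?M p" for s p
    proof -
      have pV: "p \<in> Pow V \<times> Pow V" using p IV by blast
      have sc: "s \<in> candidates S ?M p" and min: "\<forall>t\<in>candidates S ?M p. crossing_number S s \<le> crossing_number S t"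
        using s by (simp_all add: least_crossing_def)
      have sS: "s \<in> S" using sc by (simp add: candidates_def)
      have "crossing_number S (?g s) \<le> crossing_number S t" if t: "t \<in> candidates S ?M (?g p)" for t
      proof -
        have "t \<in> S" using t by (simp add: candidates_def)
        then obtain t' where t': "t' \<in> S" "t = ?g t'" using gS by blast
        then have "t' \<in> candidates S ?M p" using t cand[OF M sel pV] by simp
        then show ?thesis using min t' cross sS by simp
      qed
      then show ?thesis using sc cand[OF M sel pV sS] by (simp add: least_crossing_def)
    qed
    show ?case
    proof
      fix t assume "t \<in> ?g ` selection S I (Suc l)"
      then obtain s where s: "s \<in> selection S I (Suc l)" "t = ?g s" by blast
      then consider "s \<in> ?M" | p where "p \<in> I" "level S p = l" "s \<in> least_crossing S ?M p" by auto
      then show "t \<in> selection S I (Suc l)"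
      proof cases
        case 1
        then show ?thesis using Suc.IH s(2) by auto
      next
        case 2
        have "?g p \<in> I" using I 2(1) by blast
        moreover have "level S (?g p) = l" using level 2(1,2) IV by blast
        ultimately show ?thesis using least_crossing[OF 2(1,3)] s(2) by auto
      qed
    qed
  qed
qed

section \<open>Separations, blocks and robustness in a graph\<close>

lemma separation_iff:
  assumes "pair_graph G"
  shows "separation G s \<longleftrightarrow> fst s \<union> snd s = pverts G \<and>
    (\<forall>(u, v)\<in>parcs G. {u, v} \<subseteq> fst s \<or> {u, v} \<subseteq> snd s)"
proof -
  obtain A B where [simp]: "s = (A, B)" by (cases s)
  have "separation G s \<longleftrightarrow> A \<union> B = pverts G \<and>
      {e \<in> parcs G. fst e \<in> A \<and> snd e \<in> A} \<union> {e \<in> parcs G. fst e \<in> B \<and> snd e \<in> B} = parcs G"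
    by (auto simp: Digraph_Component.union_def with_proj_def)
  also have "{e \<in> parcs G. fst e \<in> A \<and> snd e \<in> A} \<union> {e \<in> parcs G. fst e \<in> B \<and> snd e \<in> B} = parcs G
      \<longleftrightarrow> (\<forall>e\<in>parcs G. fst e \<in> A \<and> snd e \<in> A \<or> fst e \<in> B \<and> snd e \<in> B)"
    by blast
  finally show ?thesis by (simp add: case_prod_unfold)
qed

locale finite_graph =
  fixes G :: "'a pair_pre_digraph"
  assumes G: "pair_graph G"
begin

sublocale pair_graph G by (rule G)

abbreviation V :: "'a set" where "V \<equiv> pverts G"
abbreviation seps :: "('a set \<times> 'a set) set" where "seps \<equiv> {s. separation G s}"

lemma sides: "s \<in> seps \<Longrightarrow> fst s \<union> snd s = V"
  by (simp add: separation_iff[OF G])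

lemma edge_side: "s \<in> seps \<Longrightarrow> (u, v) \<in> parcs G \<Longrightarrow> {u, v} \<subseteq> fst s \<or> {u, v} \<subseteq> snd s"
  by (auto simp: separation_iff[OF G])

lemma sepI:
  assumes "fst s \<union> snd s = V" "\<And>u v. (u, v) \<in> parcs G \<Longrightarrow> {u, v} \<subseteq> fst s \<or> {u, v} \<subseteq> snd s"
  shows "s \<in> seps"
  using assms by (auto simp: separation_iff[OF G])

lemma seps_Pow: "seps \<subseteq> Pow V \<times> Pow V"
  using sides by (force simp: mem_Times_iff)

lemma swap_sep: "s \<in> seps \<Longrightarrow> prod.swap s \<in> seps"
  by (rule sepI) (use sides[of s] edge_side[of s] in \<open>auto simp del: mem_Collect_eq\<close>)

lemma corner_sep: "s \<in> seps \<Longrightarrow> t \<in> seps \<Longrightarrow> corner s t \<in> seps"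
proof (rule sepI)
  assume s: "s \<in> seps" and t: "t \<in> seps"
  show "fst (corner s t) \<union> snd (corner s t) = V"
    using sides[OF s] sides[OF t] by auto
  fix u v assume "(u, v) \<in> parcs G"
  from edge_side[OF s this] edge_side[OF t this]
  show "{u, v} \<subseteq> fst (corner s t) \<or> {u, v} \<subseteq> snd (corner s t)" by auto
qed

text \<open>
  Outside the separator no edge leaves \<open>fst s - snd s\<close>.
\<close>
lemma reachable_stays_on_side:
  assumes s: "s \<in> seps" and u: "u \<in> fst s - snd s"
    and r: "u \<rightarrow>\<^sup>*\<^bsub>with_proj G \<restriction> (V - fst s \<inter> snd s)\<^esub> w"
  shows "w \<in> fst s - snd s"
proof -
  interpret H: wf_digraph "with_proj G \<restriction> (V - fst s \<inter> snd s)" by (rule wellformed_induce_subgraph)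
  from r show ?thesis
  proof (induction rule: H.reachable_induct)
    case base
    show ?case by (rule u)
  next
    case (step x y)
    then have "(x, y) \<in> parcs G" "y \<in> V - fst s \<inter> snd s" by (auto simp: arcs_ends_conv)
    then show ?case using edge_side[OF s] step.IH by blast
  qed
qed

text \<open>
  Inseparability in terms of separations instead of paths. A set \<open>Z\<close> that separates \<open>u\<close>
  from \<open>v\<close> is the separator of a separation, one side of which is \<open>Z\<close> together with
  everything reachable from \<open>u\<close>.
\<close>
lemma inseparable_iff:
  "inseparable G k X \<longleftrightarrow> X \<subseteq> V \<and> k < card X \<and>
     (\<forall>s\<in>seps. sep_order s \<le> k \<longrightarrow> X \<subseteq> fst s \<or> X \<subseteq> snd s)"
proof -
  have *: "X \<subseteq> fst s \<or> X \<subseteq> snd s"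
    if insep: "inseparable G k X" and s: "s \<in> seps" "sep_order s \<le> k" for s
  proof (rule ccontr)
    assume "\<not> ?thesis"
    then obtain x y where xy: "x \<in> X" "x \<notin> snd s" "y \<in> X" "y \<notin> fst s" by blast
    have "X \<subseteq> V" using insep by (simp add: inseparable_def)
    then have "x \<in> fst s" using xy sides[OF s(1)] by blast
    then have "separates G (fst s \<inter> snd s) x y"
      using reachable_stays_on_side[OF s(1), of x y] xy unfolding separates_def by blast
    moreover have "fst s \<inter> snd s \<subseteq> V" using sides[OF s(1)] by blast
    moreover have "card (fst s \<inter> snd s) \<le> k" using s(2) by (simp add: sep_order_fst_snd)
    moreover have "x \<in> X - fst s \<inter> snd s" "y \<in> X - fst s \<inter> snd s" "x \<noteq> y"
      using xy \<open>x \<in> fst s\<close> by auto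
    ultimately show False using insep unfolding inseparable_def by blast
  qed
  have **: False
    if X: "X \<subseteq> V" and side: "\<forall>s\<in>seps. sep_order s \<le> k \<longrightarrow> X \<subseteq> fst s \<or> X \<subseteq> snd s"
      and Z: "Z \<subseteq> V" "card Z \<le> k" "u \<in> X - Z" "v \<in> X - Z" and sep: "separates G Z u v" for Z u v
  proof -
    interpret H: wf_digraph "with_proj G \<restriction> (V - Z)" by (rule wellformed_induce_subgraph)
    define R where "R = {w. u \<rightarrow>\<^sup>*\<^bsub>with_proj G \<restriction> (V - Z)\<^esub> w}"
    have RV: "R \<subseteq> V - Z"
      using H.reachable_in_verts(2) unfolding R_def by auto
    have uR: "u \<in> R" using X Z by (auto simp: R_def)
    have step: "b \<in> R \<union> Z" if "a \<in> R" "(a, b) \<in> parcs G" for a b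
    proof (cases "b \<in> Z")
      case False
      then have "a \<rightarrow>\<^bsub>with_proj G \<restriction> (V - Z)\<^esub> b"
        using that RV wellformed'[OF that(2)] by (auto simp: arcs_ends_conv intro!: rev_image_eqI)
      then show ?thesis using that(1) H.reachable_adj_trans by (auto simp: R_def)
    qed simp
    let ?s = "(R \<union> Z, V - R)"
    have "?s \<in> seps"
    proof (rule sepI)
      show "fst ?s \<union> snd ?s = V" using RV Z(1) by auto
      fix a b assume ab: "(a, b) \<in> parcs G"
      then show "{a, b} \<subseteq> fst ?s \<or> {a, b} \<subseteq> snd ?s"
        using step[OF _ ab] step[OF _ arcs_symmetric[OF ab]] wellformed'[OF ab] by auto
    qed
    moreover have "(R \<union> Z) \<inter> (V - R) = Z" using RV Z(1) by blast
    then have "sep_order ?s \<le> k" using Z(2) by simp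
    ultimately have "X \<subseteq> R \<union> Z \<or> X \<subseteq> V - R" using side by fastforce
    moreover have "v \<notin> R" using sep by (simp add: separates_def R_def)
    ultimately show False using Z uR by blast
  qed
  show ?thesis
    using * ** unfolding inseparable_def by blast
qed

text \<open>
  By maximality the union of two distinct blocks is not inseparable. The separation
  witnessing this has each block on one side, and not both on the same.
\<close>
lemma blocks_distinguishable:
  assumes X: "block G k X" and Y: "block G k Y" and "X \<noteq> Y"
  shows "\<exists>s\<in>seps. distinguishes s (X, Y) \<and> sep_order s \<le> k"
proof -
  have iX: "inseparable G k X" and iY: "inseparable G k Y" using X Y by (simp_all add: block_def)
  have "\<not> inseparable G k (X \<union> Y)" using X Y \<open>X \<noteq> Y\<close> unfolding block_def by blast
  moreover have "X \<union> Y \<subseteq> V" using iX iY by (simp add: inseparable_def)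
  moreover have "card X \<le> card (X \<union> Y)"
    using calculation(2) pair_finite_verts by (intro card_mono) (auto intro: finite_subset)
  then have "k < card (X \<union> Y)" using iX by (simp add: inseparable_def)
  ultimately obtain s where s: "s \<in> seps" "sep_order s \<le> k" "\<not> X \<union> Y \<subseteq> fst s" "\<not> X \<union> Y \<subseteq> snd s"
    unfolding inseparable_iff by blast
  have "X \<subseteq> fst s \<or> X \<subseteq> snd s" "Y \<subseteq> fst s \<or> Y \<subseteq> snd s"
    using iX iY s(1,2) unfolding inseparable_iff by blast+
  then have "distinguishes s (X, Y) \<or> distinguishes (prod.swap s) (X, Y)"
    using s(3,4) by (auto simp: distinguishes_def)
  then show ?thesis using s(1,2) swap_sep[OF s(1)] sep_order_swap by metis
qed

lemma corner_boundary_eq: "corner_boundary s t = fst (corner s t) \<inter> snd (corner s t)"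
  by (cases s; cases t) auto

lemma robust_iff:
  "robust G K k U \<longleftrightarrow> inseparable G k U \<and>
     (\<forall>s\<in>seps. \<forall>t\<in>seps. sep_order s = k \<and> U \<subseteq> fst s \<and> int (sep_order t) \<le> K \<and> crosses s t \<and>
       sep_order (corner s t) < k \<and> sep_order (corner s (prod.swap t)) < k \<longrightarrow>
       U \<subseteq> fst t \<or> U \<subseteq> snd t)"
proof -
  have swap_all: "(\<forall>s\<in>seps. P (prod.swap s)) \<longleftrightarrow> (\<forall>s\<in>seps. P s)" for P
    using swap_sep by (metis swap_swap)
  have "robust G K k U \<longleftrightarrow> inseparable G k U \<and>
     (\<forall>s\<in>seps. \<forall>t\<in>seps. sep_order s = k \<and> U \<subseteq> snd s \<and> int (sep_order t) \<le> K \<and> crosses t s \<and>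
       card (corner_boundary t (prod.swap s)) < k \<and>
       card (corner_boundary (prod.swap t) (prod.swap s)) < k \<longrightarrow>
       U \<subseteq> fst t \<or> U \<subseteq> snd t)"
    unfolding robust_def
    by (simp add: split_paired_All Ball_def del: separation.simps sep_order.simps corner_boundary.simps) blast
  also have "\<dots> \<longleftrightarrow> inseparable G k U \<and>
     (\<forall>s\<in>seps. \<forall>t\<in>seps. sep_order (prod.swap s) = k \<and> U \<subseteq> snd (prod.swap s) \<and>
       int (sep_order t) \<le> K \<and> crosses t (prod.swap s) \<and>
       card (corner_boundary t (prod.swap (prod.swap s))) < k \<and>
       card (corner_boundary (prod.swap t) (prod.swap (prod.swap s))) < k \<longrightarrow>
       U \<subseteq> fst t \<or> U \<subseteq> snd t)"
    by (subst (2) swap_all[symmetric]) simp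
  finally show ?thesis
    by (simp add: corner_boundary_eq sep_order_fst_snd[of "corner _ _"] Int_commute Un_commute nested_sym
        del: mem_Collect_eq)
qed

text \<open>
  Adding \<open>k - sep_order s\<close> vertices of \<open>fst s - snd s\<close> to the second side raises the order
  of \<open>s\<close> to \<open>k\<close> and that of each of the two corners by at most the same amount. If \<open>t\<close>
  became nested with the enlarged separation, then it would have been nested with \<open>s\<close>, or
  one of its sides would contain \<open>U\<close>.
\<close>
lemma robust_lower_order:
  assumes rob: "robust G K k U" and s: "s \<in> seps" "U \<subseteq> fst s" "sep_order s \<le> k"
    and t: "t \<in> seps" "int (sep_order t) \<le> K" and cross: "crosses s t"
    and corners: "sep_order (corner s t) < sep_order s" "sep_order (corner s (prod.swap t)) < sep_order s"
  shows "U \<subseteq> fst t \<or> U \<subseteq> snd t"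
proof (rule ccontr)
  assume nU: "\<not> ?thesis"
  have U: "U \<subseteq> V" "k < card U" using rob by (simp_all add: robust_def inseparable_def)
  have fin: "finite X" if "X \<subseteq> V" for X using that pair_finite_verts finite_subset by blast
  have sub: "fst s \<subseteq> V" "snd s \<subseteq> V" "fst t \<subseteq> V" "snd t \<subseteq> V" using sides[OF s(1)] sides[OF t(1)] by blast+
  note fins = sub[THEN fin]
  have "card (fst s) = card (fst s - snd s) + sep_order s"
    using card_Int_Diff[OF fins(1), of "snd s"] by (simp add: sep_order_fst_snd)
  moreover have "card U \<le> card (fst s)" by (rule card_mono[OF fins(1) s(2)])
  ultimately have "k - sep_order s \<le> card (fst s - snd s)" using U(2) by linarith
  then obtain Z where Z: "Z \<subseteq> fst s - snd s" "card Z = k - sep_order s"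
    using obtain_subset_with_card_n by metis
  have finZ: "finite Z" using Z(1) fins(1) by (meson finite_Diff finite_subset)
  let ?s = "(fst s, snd s \<union> Z)"
  have sep: "?s \<in> seps"
    by (rule sepI) (use sides[OF s(1)] edge_side[OF s(1)] Z(1) in fastforce)+
  have "fst s \<inter> (snd s \<union> Z) = (fst s \<inter> snd s) \<union> Z" using Z(1) by blast
  moreover have "card ((fst s \<inter> snd s) \<union> Z) = sep_order s + (k - sep_order s)"
    using card_Un_disjoint[of "fst s \<inter> snd s" Z] Z fins finZ by (auto simp: sep_order_fst_snd)
  ultimately have order: "sep_order ?s = k" using s(3) by (simp add: sep_order_fst_snd)
  have corner: "sep_order (corner ?s t') < k"
    if t': "sep_order (corner s t') < sep_order s" "fst t' \<subseteq> V" "snd t' \<subseteq> V" for t'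
  proof -
    let ?X = "fst (corner s t') \<inter> snd (corner s t')"
    have "fst (corner ?s t') \<inter> snd (corner ?s t') \<subseteq> ?X \<union> Z" by auto
    moreover have "finite ?X" using fins(1) by simp
    ultimately have "sep_order (corner ?s t') \<le> card (?X \<union> Z)"
      unfolding sep_order_fst_snd using finZ by (intro card_mono) auto
    also have "\<dots> \<le> sep_order (corner s t') + (k - sep_order s)"
      using card_Un_le[of ?X Z] Z(2) by (simp add: sep_order_fst_snd)
    finally show ?thesis using t'(1) s(3) by linarith
  qed
  have "crosses ?s t"
    using nU s(2) cross unfolding nested_iff sep_le_fst_snd by auto
  then have "U \<subseteq> fst t \<or> U \<subseteq> snd t"
    using rob sep order s(2) t corner[OF corners(1)] corner[OF corners(2)] sub
    unfolding robust_iff by (metis fst_conv fst_swap snd_swap)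
  then show False using nU by blast
qed

end


context finite_graph
begin

section \<open>Invariance under automorphisms\<close>

lemma graph_auto_bij: "\<alpha> \<in> graph_auto G \<Longrightarrow> bij_betw \<alpha> V V"
  by (auto simp: graph_auto_def Bij_def)

lemma finite_seps: "finite seps"
  by (rule finite_subset[OF seps_Pow]) (simp add: pair_finite_verts)

lemma sep_image_seps:
  assumes \<alpha>: "\<alpha> \<in> graph_auto G"
  shows "sep_image \<alpha> ` seps = seps"
proof (rule endo_inj_surj[OF finite_seps])
  have V: "\<alpha> ` V = V" and inj: "inj_on \<alpha> V" using graph_auto_bij[OF \<alpha>] by (auto simp: bij_betw_def)
  show "inj_on (sep_image \<alpha>) seps" by (rule inj_on_subset[OF sep_image_inj[OF inj] seps_Pow])
  show "sep_image \<alpha> ` seps \<subseteq> seps"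
  proof (intro image_subsetI sepI)
    fix s assume s: "s \<in> seps"
    show "fst (sep_image \<alpha> s) \<union> snd (sep_image \<alpha> s) = V"
      using sides[OF s] V by (simp add: sep_image_def flip: image_Un)
    fix u v assume uv: "(u, v) \<in> parcs G"
    then obtain u' v' where uv': "u = \<alpha> u'" "v = \<alpha> v'" "u' \<in> V" "v' \<in> V"
      using wellformed'[OF uv] V by blast
    then have "(u', v') \<in> parcs G" using uv \<alpha> by (auto simp: graph_auto_def)
    from edge_side[OF s this]
    show "{u, v} \<subseteq> fst (sep_image \<alpha> s) \<or> {u, v} \<subseteq> snd (sep_image \<alpha> s)"
      by (auto simp: sep_image_def uv')
  qed
qed

lemma ball_sep_image:
  assumes \<alpha>: "\<alpha> \<in> graph_auto G"
  shows "(\<forall>s\<in>seps. P s) \<longleftrightarrow> (\<forall>s\<in>seps. P (sep_image \<alpha> s))"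
  using sep_image_seps[OF \<alpha>] by (metis (no_types, lifting) imageE imageI)

lemma image_sides:
  assumes \<alpha>: "\<alpha> \<in> graph_auto G" and X: "X \<subseteq> V" and s: "s \<in> seps"
  shows "\<alpha> ` X \<subseteq> fst (sep_image \<alpha> s) \<longleftrightarrow> X \<subseteq> fst s"
    and "\<alpha> ` X \<subseteq> snd (sep_image \<alpha> s) \<longleftrightarrow> X \<subseteq> snd s"
proof -
  have inj: "inj_on \<alpha> V" using graph_auto_bij[OF \<alpha>] by (auto simp: bij_betw_def)
  have "fst s \<subseteq> V" "snd s \<subseteq> V" using sides[OF s] by blast+
  then show "\<alpha> ` X \<subseteq> fst (sep_image \<alpha> s) \<longleftrightarrow> X \<subseteq> fst s"
    and "\<alpha> ` X \<subseteq> snd (sep_image \<alpha> s) \<longleftrightarrow> X \<subseteq> snd s"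
    using inj_on_image_subset_cancel[OF inj X] by (simp_all add: sep_image_def)
qed

lemma inseparable_image:
  assumes \<alpha>: "\<alpha> \<in> graph_auto G" and X: "X \<subseteq> V"
  shows "inseparable G k (\<alpha> ` X) \<longleftrightarrow> inseparable G k X"
proof -
  have V: "\<alpha> ` V = V" and inj: "inj_on \<alpha> V" using graph_auto_bij[OF \<alpha>] by (auto simp: bij_betw_def)
  have "card (\<alpha> ` X) = card X" by (rule card_image[OF inj_on_subset[OF inj X]])
  moreover have "\<alpha> ` X \<subseteq> V" using X V by blast
  moreover have "(\<forall>s\<in>seps. sep_order s \<le> k \<longrightarrow> \<alpha> ` X \<subseteq> fst s \<or> \<alpha> ` X \<subseteq> snd s) \<longleftrightarrow>
      (\<forall>s\<in>seps. sep_order s \<le> k \<longrightarrow> X \<subseteq> fst s \<or> X \<subseteq> snd s)"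
    unfolding ball_sep_image[OF \<alpha>, of "\<lambda>s. sep_order s \<le> k \<longrightarrow> \<alpha> ` X \<subseteq> fst s \<or> \<alpha> ` X \<subseteq> snd s"]
  proof (rule ball_cong[OF refl])
    fix s assume s: "s \<in> seps"
    then have "sep_order (sep_image \<alpha> s) = sep_order s"
      using seps_Pow by (intro sep_order_sep_image[OF inj]) blast
    then show "(sep_order (sep_image \<alpha> s) \<le> k \<longrightarrow> \<alpha> ` X \<subseteq> fst (sep_image \<alpha> s) \<or> \<alpha> ` X \<subseteq> snd (sep_image \<alpha> s))
        \<longleftrightarrow> (sep_order s \<le> k \<longrightarrow> X \<subseteq> fst s \<or> X \<subseteq> snd s)"
      by (simp add: image_sides[OF \<alpha> X s])
  qed
  ultimately show ?thesis using X unfolding inseparable_iff by simp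
qed

lemma robust_block_image:
  assumes \<alpha>: "\<alpha> \<in> graph_auto G" and X: "robust_block G K k X"
  shows "robust_block G K k (\<alpha> ` X)"
proof -
  have V: "\<alpha> ` V = V" and inj: "inj_on \<alpha> V" using graph_auto_bij[OF \<alpha>] by (auto simp: bij_betw_def)
  have block: "block G k X" and rob: "robust G K k X" using X by (simp_all add: robust_block_def)
  have insep: "inseparable G k X" using block by (simp add: block_def)
  have XV: "X \<subseteq> V" using insep by (simp add: inseparable_def)
  have insep': "inseparable G k (\<alpha> ` X)" using inseparable_image[OF \<alpha> XV] insep by simp
  have "Y = \<alpha> ` X" if Y: "inseparable G k Y" "\<alpha> ` X \<subseteq> Y" for Y
  proof -
    have "Y \<subseteq> \<alpha> ` V" using Y(1) V by (simp add: inseparable_def)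
    then obtain Y' where Y': "Y' \<subseteq> V" "Y = \<alpha> ` Y'" by (meson subset_imageE)
    have "inseparable G k Y'" using inseparable_image[OF \<alpha> Y'(1)] Y Y' by simp
    moreover have "X \<subseteq> Y'" using inj_on_image_subset_cancel[OF inj XV Y'(1)] Y Y' by simp
    ultimately show ?thesis using block Y'(2) unfolding block_def by blast
  qed
  then have "block G k (\<alpha> ` X)" using insep' by (simp add: block_def)
  moreover have "robust G K k (\<alpha> ` X)"
    unfolding robust_iff
  proof (intro conjI insep' ballI impI, elim conjE)
    fix gs gt assume gst: "gs \<in> seps" "gt \<in> seps"
      and *: "sep_order gs = k" "\<alpha> ` X \<subseteq> fst gs" "int (sep_order gt) \<le> K" "crosses gs gt"
        "sep_order (corner gs gt) < k" "sep_order (corner gs (prod.swap gt)) < k"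
    have im: "gs \<in> sep_image \<alpha> ` seps" "gt \<in> sep_image \<alpha> ` seps"
      using gst by (simp_all only: sep_image_seps[OF \<alpha>])
    obtain s where s: "s \<in> seps" "gs = sep_image \<alpha> s"
      using im(1) by (rule imageE)
    obtain t where t: "t \<in> seps" "gt = sep_image \<alpha> t"
      using im(2) by (rule imageE)
    note st = *[unfolded s(2) t(2)]
    note gt = t(2) and s = s(1) and t = t(1)
    note c = corner_sep[OF s t] corner_sep[OF s swap_sep[OF t]]
    have sV: "s \<in> Pow V \<times> Pow V" "t \<in> Pow V \<times> Pow V" "prod.swap t \<in> Pow V \<times> Pow V"
      "corner s t \<in> Pow V \<times> Pow V" "corner s (prod.swap t) \<in> Pow V \<times> Pow V"
      using s t swap_sep[OF t] c seps_Pow by blast+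
    have "sep_order s = k" "X \<subseteq> fst s" "int (sep_order t) \<le> K" "crosses s t"
      "sep_order (corner s t) < k" "sep_order (corner s (prod.swap t)) < k"
      using st image_sides(1)[OF \<alpha> XV s]
      by (simp_all add: swap_sep_image sep_order_sep_image[OF inj] corner_sep_image[OF inj]
          nested_sep_image[OF inj] sV del: mem_Collect_eq)
    then have "X \<subseteq> fst t \<or> X \<subseteq> snd t" using rob s t unfolding robust_iff by blast
    then show "\<alpha> ` X \<subseteq> fst gt \<or> \<alpha> ` X \<subseteq> snd gt"
      using image_sides[OF \<alpha> XV t] gt by simp
  qed
  ultimately show ?thesis by (simp add: robust_block_def)
qed

section \<open>The nested set of distinguishers of robust blocks\<close>

definition robust_pairs :: "int \<Rightarrow> ('a set \<times> 'a set) set" where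
  "robust_pairs K = {(X, Y). X \<noteq> Y \<and>
     (\<exists>k. int k \<le> K \<and> robust_block G K k X \<and> robust_block G K k Y)}"

text \<open>
  Some separation of order at most \<open>k\<close> distinguishes two \<open>k\<close>-blocks, which bounds the
  level. A pair may consist of blocks for several \<open>k\<close>; any of them serves.
\<close>
lemma robust_pairE:
  assumes "p \<in> robust_pairs K"
  obtains X Y k where "p = (X, Y)" "X \<noteq> Y" "int k \<le> K" "robust_block G K k X" "robust_block G K k Y"
    "inseparable G k X" "level seps p \<le> k"
proof -
  obtain X Y k where p: "p = (X, Y)" "X \<noteq> Y" "int k \<le> K" "robust_block G K k X" "robust_block G K k Y"
    using assms by (auto simp: robust_pairs_def)
  have b: "block G k X" "block G k Y" using p by (simp_all add: robust_block_def)
  obtain s where s: "s \<in> seps" "distinguishes s (X, Y)" "sep_order s \<le> k"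
    using blocks_distinguishable[OF b p(2)] by blast
  have "level seps p \<le> sep_order s"
    unfolding level_def p(1) by (rule Least_le) (use s in blast)
  moreover have "inseparable G k X" using b by (simp add: block_def)
  ultimately show ?thesis using that p s(3) by simp
qed

lemma distinguishable_robust_pairs: "distinguishable_pairs V seps (robust_pairs K)"
proof
  show "finite V" by (rule pair_finite_verts)
  show "\<And>s. s \<in> seps \<Longrightarrow> fst s \<union> snd s = V" by (rule sides)
  show "\<And>s. s \<in> seps \<Longrightarrow> prod.swap s \<in> seps" by (rule swap_sep)
  show "\<And>s t. s \<in> seps \<Longrightarrow> t \<in> seps \<Longrightarrow> corner s t \<in> seps" by (rule corner_sep)
  show "\<And>p. p \<in> robust_pairs K \<Longrightarrow> prod.swap p \<in> robust_pairs K" by (auto simp: robust_pairs_def)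
  show "\<exists>s\<in>seps. distinguishes s p" if p: "p \<in> robust_pairs K" for p
  proof -
    obtain X Y k where "p = (X, Y)" "X \<noteq> Y" "robust_block G K k X" "robust_block G K k Y"
      using robust_pairE[OF p] by metis
    then show ?thesis using blocks_distinguishable unfolding robust_block_def by blast
  qed
  show "fst p \<subseteq> fst s \<or> fst p \<subseteq> snd s"
    if p: "p \<in> robust_pairs K" and s: "s \<in> seps" "sep_order s \<le> level seps p" for p s
  proof -
    obtain k where "inseparable G k (fst p)" "level seps p \<le> k"
      using robust_pairE[OF p] by (metis fst_conv)
    then show ?thesis using s unfolding inseparable_iff by (meson le_trans)
  qed
  show "level seps p < card (fst p)" if p: "p \<in> robust_pairs K" for p
  proof -
    obtain k where "inseparable G k (fst p)" "level seps p \<le> k"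
      using robust_pairE[OF p] by (metis fst_conv)
    then show ?thesis unfolding inseparable_def by linarith
  qed
  show "fst p \<subseteq> fst t \<or> fst p \<subseteq> snd t"
    if p: "p \<in> robust_pairs K" and q: "q \<in> robust_pairs K" and s: "s \<in> seps" and t: "t \<in> seps"
      and st: "fst p \<subseteq> fst s" "sep_order s = level seps p" "sep_order t = level seps q" "crosses s t"
        "sep_order (corner s t) < level seps p" "sep_order (corner s (prod.swap t)) < level seps p"
    for p q s t
  proof -
    obtain k where k: "robust_block G K k (fst p)" "level seps p \<le> k"
      using robust_pairE[OF p] by (metis fst_conv)
    obtain m where m: "int m \<le> K" "level seps q \<le> m" using robust_pairE[OF q] by metis
    have "robust G K k (fst p)" using k(1) by (simp add: robust_block_def)
    then show ?thesis
      by (rule robust_lower_order[OF _ s st(1) _ t]) (use st k m in simp_all)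
  qed
qed

text \<open>
  \<open>selection\<close> stops strictly below its index, hence the successor.
\<close>
definition nested_distinguishers :: "int \<Rightarrow> nat \<Rightarrow> ('a set \<times> 'a set) set" where
  "nested_distinguishers K k = selection seps (robust_pairs K) (Suc k)"

lemma nested_distinguishers:
  shows "\<And>s. s \<in> nested_distinguishers K k \<Longrightarrow> s \<in> seps \<and> sep_order s \<le> k"
    and "tree_set (nested_distinguishers K k)"
    and "\<And>p. p \<in> robust_pairs K \<Longrightarrow> level seps p \<le> k \<Longrightarrow> \<exists>s\<in>nested_distinguishers K k. s \<in> candidates seps {} p"
    and "\<And>\<alpha> s. \<alpha> \<in> graph_auto G \<Longrightarrow> s \<in> nested_distinguishers K k \<Longrightarrow> sep_image \<alpha> s \<in> nested_distinguishers K k"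
proof -
  interpret D: distinguishable_pairs V seps "robust_pairs K" by (rule distinguishable_robust_pairs)
  let ?N = "nested_distinguishers K k"
  note props = D.selection_props[of "Suc k", folded nested_distinguishers_def]
  have orig: "\<exists>p\<in>robust_pairs K. s \<in> candidates seps {} p \<and> level seps p < Suc k" if "s \<in> ?N" for s
    using props that by blast
  show sub: "s \<in> seps \<and> sep_order s \<le> k" if "s \<in> ?N" for s
    using orig[OF that] by (auto simp: candidates_def)
  show "tree_set ?N"
  proof
    show "finite ?N" by (rule finite_subset[OF _ finite_seps]) (use sub in blast)
    show "\<And>s. s \<in> ?N \<Longrightarrow> prod.swap s \<in> ?N" using props by blast
    show "\<And>s t. s \<in> ?N \<Longrightarrow> t \<in> ?N \<Longrightarrow> nested s t" using props by blast
    show "\<And>s. s \<in> ?N \<Longrightarrow> \<not> sep_le s (prod.swap s)" using orig D.not_small by blast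
  qed
  show "\<exists>s\<in>?N. s \<in> candidates seps {} p" if "p \<in> robust_pairs K" "level seps p \<le> k" for p
    using props that less_Suc_eq_le by blast
  show "sep_image \<alpha> s \<in> ?N" if \<alpha>: "\<alpha> \<in> graph_auto G" and s: "s \<in> ?N" for \<alpha> s
  proof -
    have V: "robust_pairs K \<subseteq> Pow V \<times> Pow V"
      by (auto simp: robust_pairs_def robust_block_def block_def inseparable_def)
    have "sep_image \<alpha> p \<in> robust_pairs K" if p: "p \<in> robust_pairs K" for p
    proof -
      obtain X Y k where XY: "p = (X, Y)" "X \<noteq> Y" "int k \<le> K" "robust_block G K k X" "robust_block G K k Y"
        using robust_pairE[OF p] by metis
      have "X \<subseteq> V" "Y \<subseteq> V" using V p XY(1) by auto
      then have "\<alpha> ` X \<noteq> \<alpha> ` Y"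
        using XY(2) graph_auto_bij[OF \<alpha>] inj_on_image_eq_iff[of \<alpha> V X Y] by (simp add: bij_betw_def)
      then show ?thesis
        using XY robust_block_image[OF \<alpha>] by (auto simp: robust_pairs_def sep_image_def)
    qed
    then have I: "sep_image \<alpha> ` robust_pairs K \<subseteq> robust_pairs K" by blast
    have S: "sep_image \<alpha> ` seps \<subseteq> seps" using sep_image_seps[OF \<alpha>] by simp
    show ?thesis
      using D.selection_sep_image[OF V graph_auto_bij[OF \<alpha>] S I] s
      unfolding nested_distinguishers_def by blast
  qed
qed

end

text \<open>
  A part cannot contain two robust blocks \<open>X\<close> and \<open>Y\<close>: it lies on one side of a separation
  that distinguishes them, and the block on the other side would be contained in a
  separator of order at most \<open>k\<close>.
\<close>
theorem theorem6p5:
  fixes G :: "'a pair_pre_digraph" and K :: int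
  assumes "pair_graph G"
  shows "\<exists>(T :: nat \<Rightarrow> nat pair_pre_digraph) (V :: nat \<Rightarrow> nat \<Rightarrow> 'a set).
    \<forall>k. int k \<le> K \<longrightarrow>
      tree_decomposition G (T k) (V k) \<and>
      (\<forall>X. inseparable G k X \<longrightarrow> (\<exists>!t. t \<in> pverts (T k) \<and> X \<subseteq> V k t)) \<and>
      (\<forall>X Y t t'. robust_block G K k X \<and> robust_block G K k Y \<and> X \<noteq> Y \<and>
         t \<in> pverts (T k) \<and> t' \<in> pverts (T k) \<and> X \<subseteq> V k t \<and> Y \<subseteq> V k t' \<longrightarrow> V k t \<noteq> V k t') \<and>
      adhesion (T k) (V k) \<le> k \<and>
      (k > 0 \<longrightarrow> td_le (T (k - 1)) (V (k - 1)) (T k) (V k)) \<and>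
      induces_action G (T k) (V k)"
proof -
  interpret finite_graph G by (rule finite_graph.intro[OF assms])
  define N where "N = nested_distinguishers K"
  define T where "T k = orientation_tree (N k)" for k
  define P where "P k i = part_of V (orientation_at (N k) i)" for k i
  have tree: "tree_set (N k)" for k unfolding N_def by (rule nested_distinguishers)
  have N: "s \<in> seps" "sep_order s \<le> k" if "s \<in> N k" for s k
    using nested_distinguishers(1) that unfolding N_def by blast+
  have large: "\<not> X \<subseteq> fst s \<inter> snd s" if X: "inseparable G k X" and s: "s \<in> N k" for X s k
  proof
    assume "X \<subseteq> fst s \<inter> snd s"
    moreover have "finite (fst s \<inter> snd s)"
      using sides[OF N(1)[OF s]] pair_finite_verts by (auto intro: finite_subset)
    ultimately have "card X \<le> sep_order s" by (simp add: sep_order_fst_snd card_mono)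
    then show False using X N(2)[OF s] by (simp add: inseparable_def)
  qed
  have "tree_decomposition G (T k) (P k) \<and>
      (\<forall>X. inseparable G k X \<longrightarrow> (\<exists>!t. t \<in> pverts (T k) \<and> X \<subseteq> P k t)) \<and>
      (\<forall>X Y t t'. robust_block G K k X \<and> robust_block G K k Y \<and> X \<noteq> Y \<and>
         t \<in> pverts (T k) \<and> t' \<in> pverts (T k) \<and> X \<subseteq> P k t \<and> Y \<subseteq> P k t' \<longrightarrow> P k t \<noteq> P k t') \<and>
      adhesion (T k) (P k) \<le> k \<and>
      (k > 0 \<longrightarrow> td_le (T (k - 1)) (P (k - 1)) (T k) (P k)) \<and>
      induces_action G (T k) (P k)" if k: "int k \<le> K" for k
  proof (intro conjI allI impI)
    interpret tree_set "N k" by (rule tree)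
    show "tree_decomposition G (T k) (P k)"
      unfolding T_def P_def
      by (rule tree_decomposition_T[OF G sides[OF N(1)] edge_side[OF N(1)]])
    show "\<exists>!t. t \<in> pverts (T k) \<and> X \<subseteq> P k t" if X: "inseparable G k X" for X
      unfolding T_def P_def
    proof (rule unique_node_through)
      show "X \<subseteq> V" using X by (simp add: inseparable_def)
      show "X \<subseteq> fst s \<or> X \<subseteq> snd s" if "s \<in> N k" for s
        using X N[OF that] unfolding inseparable_iff by blast
      show "\<not> X \<subseteq> fst s \<inter> snd s" if "s \<in> N k" for s by (rule large[OF X that])
    qed
    show "P k t \<noteq> P k t'"
      if "robust_block G K k X \<and> robust_block G K k Y \<and> X \<noteq> Y \<and>
         t \<in> pverts (T k) \<and> t' \<in> pverts (T k) \<and> X \<subseteq> P k t \<and> Y \<subseteq> P k t'" for X Y t t'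
    proof
      assume eq: "P k t = P k t'"
      have X: "robust_block G K k X" and Y: "robust_block G K k Y" and "X \<noteq> Y"
        and t: "t \<in> pverts (orientation_tree (N k))" "X \<subseteq> P k t" "Y \<subseteq> P k t"
        using that eq by (simp_all add: T_def)
      have XY: "block G k X" "block G k Y" using X Y by (simp_all add: robust_block_def)
      then have insep: "inseparable G k X" "inseparable G k Y" by (simp_all add: block_def)
      have p: "(X, Y) \<in> robust_pairs K" using X Y \<open>X \<noteq> Y\<close> k by (auto simp: robust_pairs_def)
      obtain s' where "s' \<in> seps" "distinguishes s' (X, Y)" "sep_order s' \<le> k"
        using blocks_distinguishable[OF XY \<open>X \<noteq> Y\<close>] by blast
      then have "level seps (X, Y) \<le> k"
        unfolding level_def by (intro order_trans[OF Least_le]) blast+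
      then obtain s where s: "s \<in> N k" "s \<in> candidates seps {} (X, Y)"
        using nested_distinguishers(3)[OF p] unfolding N_def by blast
      then have XsY: "X \<subseteq> fst s" "Y \<subseteq> snd s" by (simp_all add: candidates_def distinguishes_def)
      have "s \<in> orientation_at (N k) t \<or> prod.swap s \<in> orientation_at (N k) t" using orientation_iff[OF L_orientation[OF t(1)] s(1)] by blast
      then have "P k t \<subseteq> snd s \<or> P k t \<subseteq> fst s"
        unfolding P_def part_of_def by auto
      then show False using t(2,3) XsY large[OF insep(1) s(1)] large[OF insep(2) s(1)] by blast
    qed
    show "adhesion (T k) (P k) \<le> k"
      unfolding T_def P_def
    proof (rule adhesion_T[OF pair_finite_verts])
      fix s assume s: "s \<in> N k"
      show "card (fst s \<inter> snd s) \<le> k" using N(2)[OF s] by (simp add: sep_order_fst_snd)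
      show "fst s \<union> snd s \<subseteq> V" using sides[OF N(1)[OF s]] by simp
    qed
    show "td_le (T (k - 1)) (P (k - 1)) (T k) (P k)"
      unfolding T_def P_def
    proof (rule td_le_orientation_trees[OF tree tree])
      show "N (k - 1) \<subseteq> N k"
        unfolding N_def nested_distinguishers_def by (rule selection_mono) simp
      show "\<And>s. s \<in> N k \<Longrightarrow> fst s \<union> snd s = V" by (rule sides[OF N(1)])
    qed
    show "induces_action G (T k) (P k)"
      unfolding T_def P_def
    proof (rule induces_action_T)
      show "N k \<subseteq> Pow V \<times> Pow V" using N(1) seps_Pow by blast
      show "\<And>\<alpha> s. \<alpha> \<in> graph_auto G \<Longrightarrow> s \<in> N k \<Longrightarrow> sep_image \<alpha> s \<in> N k"
        unfolding N_def by (rule nested_distinguishers(4))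
    qed
  qed
  then show ?thesis by blast
qed

end
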